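(* Let $g\geq2$ be an integer. Let $\mathcal{A}_g$ be the set of first dynamical degrees of surjective endomorphisms of $g$-dimensional complex abelian varieties, with the value $1$ removed, and let $\mathcal{B}_g$ be the set of first dynamical degrees of automorphisms of $g$-dimensional simple complex abelian varieties, with the value $1$ removed. Then each of $\mathcal{A}_g$ and $\mathcal{B}_g$ has a minimum element.
   Context: Endomorphisms of an abelian variety are holomorphic self-maps preserving the group structure; an automorphism is an invertible endomorphism. A complex abelian variety is simple if it contains no abelian subvarieties other than $0$ and itself. For a holomorphic self-map $f$ of a compact Kähler manifold $X$, the first dynamical degree $\lambda_1(f)$ is the spectral radius of $f^*$ on $H^{1,1}(X)$. *)

theory Defs
  imports "HOL-Analysis.Analysis"
begin

text \<open>Model: a g-dimensional complex torus is C^g / L, with C^g = complex^'n, CARD('n) = g,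
and L a full lattice (Z-span of an R-basis of C^g, which has real dimension 2g).
Holomorphic group endomorphisms of the torus are induced by C-linear maps
(matrices M) with M L \<subseteq> L.\<close>

definition full_lattice :: "(complex^'n::finite) set \<Rightarrow> bool" where
  "full_lattice L \<longleftrightarrow>
     (\<exists>B. independent B \<and> card B = DIM(complex^'n) \<and>
          L = {\<Sum>b\<in>B. of_int (k b) *\<^sub>R b | k. True})"

definition herm :: "complex^'n^'n \<Rightarrow> complex^'n \<Rightarrow> complex^'n \<Rightarrow> complex" where
  "herm H x y = (\<Sum>i\<in>UNIV. \<Sum>j\<in>UNIV. x$i * H$i$j * cnj (y$j))"

text \<open>Abelian variety (Riemann's criterion / polarizable complex torus): there is a positive
definite Hermitian form whose imaginary part is integral on the lattice.\<close>
definition abelian :: "(complex^'n::finite) set \<Rightarrow> bool" where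
  "abelian L \<longleftrightarrow> full_lattice L \<and>
     (\<exists>H::complex^'n^'n.
        (\<forall>i j. H$j$i = cnj (H$i$j)) \<and>
        (\<forall>x. x \<noteq> 0 \<longrightarrow> Re (herm H x x) > 0) \<and>
        (\<forall>u\<in>L. \<forall>v\<in>L. Im (herm H u v) \<in> \<int>))"

text \<open>Complex subtori correspond to complex subspaces W with W \<inter> L spanning W over R.
A simple abelian variety has only the trivial ones.\<close>
definition simple_av :: "(complex^'n::finite) set \<Rightarrow> bool" where
  "simple_av L \<longleftrightarrow> abelian L \<and>
     (\<forall>W. subspace W \<and> (\<forall>x\<in>W. (\<i> *s x) \<in> W) \<and> span (W \<inter> L) = W
          \<longrightarrow> W = {0} \<or> W = UNIV)"

definition endo :: "(complex^'n::finite) set \<Rightarrow> complex^'n^'n \<Rightarrow> bool" where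
  "endo L M \<longleftrightarrow> (\<forall>x\<in>L. M *v x \<in> L)"

definition surj_endo :: "(complex^'n::finite) set \<Rightarrow> complex^'n^'n \<Rightarrow> bool" where
  "surj_endo L M \<longleftrightarrow> endo L M \<and> (\<forall>y. \<exists>x. M *v x - y \<in> L)"

definition auto :: "(complex^'n::finite) set \<Rightarrow> complex^'n^'n \<Rightarrow> bool" where
  "auto L M \<longleftrightarrow> endo L M \<and> (\<exists>N. endo L N \<and> N ** M = mat 1 \<and> M ** N = mat 1)"

definition mconj :: "complex^'n^'m \<Rightarrow> complex^'n^'m" where
  "mconj M = (\<chi> i j. cnj (M$i$j))"

text \<open>H^{1,1} of the torus is the space of translation-invariant (1,1)-forms, identified with
matrices H (forms sum H_ij dz_i \<and> d(conj z_j)); the pull-back by M is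
H \<mapsto> M^T H conj(M).\<close>
definition pullback11 :: "complex^'n^'n \<Rightarrow> complex^'n^'n \<Rightarrow> complex^'n^'n" where
  "pullback11 M H = transpose M ** H ** mconj M"

definition dyn_deg1 :: "complex^'n^'n \<Rightarrow> real" where
  "dyn_deg1 M = Sup {cmod \<mu> | \<mu>. \<exists>H::complex^'n^'n. H \<noteq> 0 \<and> pullback11 M H = (\<chi> i j. \<mu> * H$i$j)}"

end

theory Submission
  imports "Jordan_Normal_Form.Char_Poly" Defs
begin

text \<open>An endomorphism acts on the lattice by an integer matrix of size $2g$ whose characteristic
  roots are, up to conjugation, the eigenvalues of $M$, and the first dynamical degree is the square
  of the largest modulus of such a root. Only finitely many monic integer polynomials of degree
  $2g$ have all their roots in a given disc, so every nonempty set of dynamical degrees has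
  a minimum.

  What remains is a simple abelian variety of dimension $g$ with an automorphism of dynamical
  degree other than 1. The polynomial $x(x-4)(x-8)...(x-4(g-1)) - 1$ is irreducible with $g$ real
  roots $r_i$, and its roots are units. The lattices
  $\{(b(r_i) + \mathrm{i}\, s_i a(r_i))_i : a, b \in Z[x]\}$ carry real multiplication by
  $\mathrm{diag}(r_i)$; a suitable choice of the $s_i$ makes them polarized, by Euler's
  formula for $\sum_i P(r_i)/p'(r_i)$, and they are simple for all but countably many values of
  the remaining parameter.\<close>

text \<open>A subtorus need not be stable under diag(r_i), so real multiplication alone does not
  make the torus simple. The way out is to keep the lattice fixed, as \<open>\<Lambda>\<close> in
  R^g x R^g, and to let only the complex structure depend on t > 0, through s_i = 1/(w_i t^(e_i)).
  The subspaces spanned by lattice vectors are then countably many and independent of t, and each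
  nontrivial equation expressing stability under i excludes finitely many t. The weights w_i =
  p'(r_i) may be negative: positivity is carried by the Hermitian form diag(t^(e_i)), and t cancels
  from its imaginary part on the lattice. The polynomial p serves three ends. Its value -1 at the g
  integers 4k forces irreducibility; its constant term -1 makes x invertible modulo p; the spacing 4
  makes the product exceed 1 in absolute value halfway between the nodes, so subtracting 1 keeps the
  sign changes. The root r_1 lies in (2, 6), which pushes the dynamical degree above 1.\<close>

no_notation vec_index (infixl \<open>$\<close> 100)
no_notation scalar_prod (infix \<open>\<bullet>\<close> 70)

section \<open>Units with real conjugates\<close>

text \<open>Gauss's lemma. Pseudo-division of p by the primitive part leaves a remainder of smaller
  degree that still vanishes at x, hence is zero. As p and the divisor have content 1, the
  multiplier c divides the quotient and can be cancelled.\<close>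

lemma int_poly_min_dvd:
  fixes p a :: "int poly" and x :: real
  assumes monic: "lead_coeff p = 1"
    and p0: "poly (of_int_poly p) x = 0"
    and a0: "poly (of_int_poly a) x = 0" and "a \<noteq> 0"
    and minimal: "\<And>b. b \<noteq> 0 \<Longrightarrow> poly (of_int_poly b) x = 0 \<Longrightarrow> degree a \<le> degree b"
  shows "primitive_part a dvd p"
proof -
  let ?a = "primitive_part a"
  have a: "?a \<noteq> 0" "degree ?a = degree a" "Polynomial.content ?a = 1"
    using \<open>a \<noteq> 0\<close> by auto
  have "a = Polynomial.smult (Polynomial.content a) ?a" by simp
  then have "poly (of_int_poly (Polynomial.smult (Polynomial.content a) ?a)) x = 0" using a0 by simp
  then have ax: "poly (of_int_poly ?a) x = 0" using \<open>a \<noteq> 0\<close>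
    unfolding of_int_hom.map_poly_hom_smult poly_smult by simp
  obtain q s where qs: "pseudo_divmod p ?a = (q, s)" by fastforce
  define c where "c = lead_coeff ?a ^ (Suc (degree p) - degree ?a)"
  have eq: "Polynomial.smult c p = ?a * q + s" and deg: "s = 0 \<or> degree s < degree ?a"
    using pseudo_divmod[OF a(1) qs] by (auto simp: c_def)
  have "c \<noteq> 0" using a(1) leading_coeff_neq_0 power_not_zero unfolding c_def by blast
  have "poly (of_int_poly (Polynomial.smult c p)) x = poly (of_int_poly (?a * q + s)) x"
    using eq by simp
  then have "poly (of_int_poly s) x = 0"
    by (simp add: of_int_hom.map_poly_hom_smult of_int_poly_hom.hom_add of_int_poly_hom.hom_mult p0 ax)
  then have "s = 0" using minimal[of s] deg a(2) by fastforce
  then have eq: "Polynomial.smult c p = ?a * q" using eq by simp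
  have "Polynomial.content p dvd 1" using content_dvd_coeff[of p "degree p"] monic by simp
  then have "Polynomial.content p = 1" using is_unit_content_iff by blast
  then have "Polynomial.content q = normalize c"
    using arg_cong[OF eq, of Polynomial.content] a(3) by (simp add: content_mult)
  then have "c dvd Polynomial.content q" by simp
  then obtain k where "Polynomial.content q = c * k" by (auto simp: dvd_def)
  then have "q = Polynomial.smult c (Polynomial.smult k (primitive_part q))"
    by (metis content_times_primitive_part smult_smult)
  then have "Polynomial.smult c p = Polynomial.smult c (?a * Polynomial.smult k (primitive_part q))"
    using eq by (metis mult_smult_right)
  then have "p = ?a * Polynomial.smult k (primitive_part q)"
    using \<open>c \<noteq> 0\<close> smult_cancel by blast
  then show ?thesis by (metis dvd_triv_left)
qed

section \<open>Irreducibility of the product minus one\<close>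

definition sep_prod :: "nat \<Rightarrow> int poly" where
  "sep_prod g = (\<Prod>k<g. [:- 4 * int k, 1:])"

lemma sep_prod_monic: "degree (sep_prod g) = g" "lead_coeff (sep_prod g) = 1"
proof -
  show "degree (sep_prod g) = g" by (simp add: sep_prod_def degree_prod_eq_sum_degree)
  show "lead_coeff (sep_prod g) = 1" unfolding sep_prod_def lead_coeff_prod by simp
qed

lemma sep_poly_monic:
  assumes "g \<ge> 1"
  shows "degree (sep_prod g - 1) = g" "lead_coeff (sep_prod g - 1) = 1"
proof -
  have d: "degree (- 1 :: int poly) < degree (sep_prod g)"
    using assms by (simp add: sep_prod_monic)
  show 1: "degree (sep_prod g - 1) = g"
    using degree_add_eq_left[OF d] sep_prod_monic by simp
  show "lead_coeff (sep_prod g - 1) = 1"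
    using sep_prod_monic[of g] assms unfolding 1 by (simp add: coeff_1)
qed

lemma poly_sep_prod_zero: "k < g \<Longrightarrow> poly (sep_prod g) (4 * int k) = 0"
  by (auto simp: sep_prod_def poly_prod intro!: prod_zero)

text \<open>At each of the g points 4k the integers a and b multiply to -1, so they are opposite. If
  both degrees were below g, then a + b would have too many zeros, and b = -a would make the leading
  coefficient minus a square.\<close>

lemma sep_poly_no_factor:
  assumes "g \<ge> 1" and ab: "sep_prod g - 1 = a * b"
    and "0 < degree a"
  shows "degree a \<ge> g"
proof (rule ccontr)
  assume "\<not> degree a \<ge> g"
  note m = sep_poly_monic[OF \<open>g \<ge> 1\<close>]
  have nz: "a \<noteq> 0" "b \<noteq> 0" using ab m \<open>g \<ge> 1\<close> by auto
  have "degree a + degree b = g"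
    using m(1) degree_mult_eq[OF nz] unfolding ab by simp
  then have deg: "degree (a + b) < g"
    using \<open>\<not> degree a \<ge> g\<close> assms(3) by (intro degree_add_less) auto
  have zero: "poly (a + b) (4 * int k) = 0" if "k < g" for k
  proof -
    have "poly a (4 * int k) * poly b (4 * int k) = - 1"
      using arg_cong[OF ab, of "\<lambda>p. poly p (4 * int k)"] poly_sep_prod_zero[OF that] by simp
    then have "poly a (4 * int k) = 1 \<and> poly b (4 * int k) = - 1 \<or>
               poly a (4 * int k) = - 1 \<and> poly b (4 * int k) = 1"
      using pos_zmult_eq_1_iff_lemma zmult_eq_1_iff[of "poly a (4 * int k)" "- poly b (4 * int k)"] by auto
    then show ?thesis by auto
  qed
  have "a + b = 0"
  proof (rule ccontr)
    assume "a + b \<noteq> 0"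
    have "(\<lambda>k. 4 * int k) ` {..<g} \<subseteq> {x. poly (a + b) x = 0}" using zero by auto
    then have "card ((\<lambda>k. 4 * int k) ` {..<g}) \<le> card {x. poly (a + b) x = 0}"
      using poly_roots_finite[OF \<open>a + b \<noteq> 0\<close>] card_mono by blast
    also have "\<dots> \<le> degree (a + b)" using \<open>a + b \<noteq> 0\<close> card_poly_roots_bound by blast
    finally show False using deg by (simp add: card_image inj_on_def)
  qed
  then have "b = - a" by (metis add.inverse_unique)
  then have "lead_coeff (sep_prod g - 1) = - (lead_coeff a * lead_coeff a)"
    unfolding ab by (simp add: lead_coeff_mult)
  then have "lead_coeff a * lead_coeff a = - 1" using m by simp
  then show False by (smt (verit) zero_le_square)
qed

text \<open>An annihilator of x of least degree has a primitive part dividing the polynomial, so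
  irreducibility gives it degree at least g. Thus 1, x, ..., x^(g-1) are independent over Z.\<close>

lemma sep_poly_minimal:
  fixes x :: real
  assumes "g \<ge> 1" and root: "poly (of_int_poly (sep_prod g - 1)) x = 0"
    and "a \<noteq> 0" and "degree a < g"
  shows "poly (of_int_poly a) x \<noteq> 0"
proof
  assume "poly (of_int_poly a) x = 0"
  define P where "P = (\<lambda>b::int poly. b \<noteq> 0 \<and> poly (of_int_poly b) x = 0)"
  have "P a" using assms(3) \<open>poly (of_int_poly a) x = 0\<close> by (simp add: P_def)
  define b where "b = arg_min degree P"
  have b: "P b" "\<And>c. P c \<Longrightarrow> degree b \<le> degree c"
    unfolding b_def using arg_min_nat_lemma[of P a degree] \<open>P a\<close> by auto
  then have dvd: "primitive_part b dvd sep_prod g - 1"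
    using int_poly_min_dvd[of "sep_prod g - 1" x b] sep_poly_monic(2)[OF \<open>g \<ge> 1\<close>] root
    by (auto simp: P_def)
  have "degree b \<noteq> 0"
  proof
    assume "degree b = 0"
    then obtain c where "b = [:c:]" by (metis degree_eq_zeroE)
    then show False using b(1) by (auto simp: P_def)
  qed
  then have "degree b \<ge> g"
    using dvd sep_poly_no_factor[OF \<open>g \<ge> 1\<close>, of "primitive_part b"] by (auto elim!: dvdE)
  then show False using b(2)[OF \<open>P a\<close>] assms(4) by simp
qed

section \<open>Real roots by sign changes\<close>

lemma sep_prod_real: "poly (of_int_poly (sep_prod g)) x = (\<Prod>k<g. x - 4 * real k)"
  by (simp add: sep_prod_def of_int_poly_hom.hom_prod poly_prod)

text \<open>Exactly g - m of the zeros 4k lie above 4m - 2, so the sign turns the product into one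
  of absolute values, and each of these is at least 2.\<close>

lemma sep_prod_midpoint:
  assumes "g \<ge> 1" "m \<le> g"
  shows "(-1) ^ (g - m) * (\<Prod>k<g. (4 * real m - 2) - 4 * real k) > 1"
proof -
  have split: "{..<g} = {..<m} \<union> {m..<g}" "{..<m} \<inter> {m..<g} = {}" using assms by auto
  have "(-1) ^ (g - m) * (\<Prod>k<g. (4 * real m - 2) - 4 * real k)
      = (\<Prod>k<m. (4 * real m - 2) - 4 * real k) * ((-1) ^ (g - m) * (\<Prod>k\<in>{m..<g}. (4 * real m - 2) - 4 * real k))"
    unfolding split(1) by (subst prod.union_disjoint) auto
  also have "(-1) ^ (g - m) * (\<Prod>k\<in>{m..<g}. (4 * real m - 2) - 4 * real k)
     = (\<Prod>k\<in>{m..<g}. (-1) * ((4 * real m - 2) - 4 * real k))"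
    by (subst prod.distrib) simp
  also have "(\<Prod>k<m. (4 * real m - 2) - 4 * real k) * (\<Prod>k\<in>{m..<g}. (-1) * ((4 * real m - 2) - 4 * real k))
     = (\<Prod>k<g. \<bar>(4 * real m - 2) - 4 * real k\<bar>)"
    unfolding split(1) by (subst prod.union_disjoint) (auto intro!: arg_cong2[of _ _ _ _ "(*)"] prod.cong)
  also have "\<dots> \<ge> (\<Prod>k<g. 2)"
  proof (intro prod_mono conjI)
    fix k
    have "real k \<ge> real m \<or> real k \<le> real m - 1" by (cases "k \<ge> m") auto
    then show "2 \<le> \<bar>4 * real m - 2 - 4 * real k\<bar>" by linarith
  qed simp
  moreover have "(\<Prod>k<g. 2) > (1::real)" using assms by (simp add: one_less_power)
  ultimately show ?thesis by linarith
qed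

text \<open>The windows (4k - 2, 4k + 2) are disjoint, so one root in each of them accounts for g
  distinct real roots.\<close>

lemma sep_poly_real_root:
  assumes "k < g"
  shows "\<exists>x::real. 4 * real k - 2 < x \<and> x < 4 * real k + 2 \<and>
           poly (of_int_poly (sep_prod g - 1)) x = 0"
proof -
  define f where "f = (\<lambda>x::real. (\<Prod>k<g. x - 4 * real k) - 1)"
  have f: "poly (of_int_poly (sep_prod g - 1)) x = f x" for x
    by (simp add: f_def sep_prod_real of_int_poly_hom.hom_minus)
  have sgn: "(-1) ^ (g - m) * f (4 * real m - 2) > 0" if "m \<le> g" for m
  proof -
    \<comment> \<open>Subtracting 1 from the product costs at most 1 after the sign is applied, and
      the signed product exceeds 1.\<close>
    have "(-1 :: real) ^ (g - m) \<le> 1" by (cases "even (g - m)") auto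
    then show ?thesis
      using sep_prod_midpoint[of g m] that assms by (simp add: f_def algebra_simps)
  qed
  have "(-1) ^ (g - k) * f (4 * real k - 2) > 0" "(-1) ^ (g - Suc k) * f (4 * real k + 2) > 0"
    using sgn[of k] sgn[of "Suc k"] assms by (simp_all add: algebra_simps)
  moreover have "(-1) ^ (g - k) = - ((-1) ^ (g - Suc k) :: real)"
    using assms by (metis Suc_diff_Suc mult_minus1 power_Suc)
  moreover have "(-1) ^ (g - Suc k) = (1::real) \<or> (-1) ^ (g - Suc k) = (-1::real)"
    by (meson neg_one_even_power neg_one_odd_power)
  ultimately have "f (4 * real k - 2) * f (4 * real k + 2) < 0"
    by (auto simp: mult_less_0_iff)
  then have "\<exists>x>4 * real k - 2. x < 4 * real k + 2 \<and> poly (of_int_poly (sep_prod g - 1)) x = 0"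
    by (intro poly_IVT) (auto simp: f)
  then show ?thesis by blast
qed

lemma exists_totally_real_unit:
  assumes "g \<ge> 2"
  obtains p h :: "int poly" and r :: "nat \<Rightarrow> real" where
    "degree p = g" "lead_coeff p = 1" "inj_on r {..<g}" "r 1 > 1"
    "\<And>k. k < g \<Longrightarrow> poly (of_int_poly p) (r k) = 0"
    "\<And>k. k < g \<Longrightarrow> r k * poly (of_int_poly h) (r k) = 1"
    "\<And>k a. k < g \<Longrightarrow> a \<noteq> 0 \<Longrightarrow> degree a < g \<Longrightarrow> poly (of_int_poly a) (r k) \<noteq> 0"
proof -
  define p where "p = sep_prod g - 1"
  define h where "h = (\<Prod>k\<in>{1..<g}. [:- 4 * int k, 1:])"
  have "\<forall>k\<in>{..<g}. \<exists>x::real. 4 * real k - 2 < x \<and> x < 4 * real k + 2 \<and> poly (of_int_poly p) x = 0"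
    unfolding p_def using sep_poly_real_root by blast
  then obtain r :: "nat \<Rightarrow> real" where
    r: "\<forall>k\<in>{..<g}. 4 * real k - 2 < r k \<and> r k < 4 * real k + 2 \<and> poly (of_int_poly p) (r k) = 0"
    by metis
  \<comment> \<open>The factor for k = 0 is x itself; the remaining factors form h, so x h = p + 1
    and h(r) is the inverse of a root r.\<close>
  have "{..<g} = insert 0 {1..<g}" using assms by auto
  then have "sep_prod g = [:0, 1:] * h" unfolding sep_prod_def h_def by simp
  then have ph: "p + 1 = [:0, 1:] * h" by (simp add: p_def)
  show ?thesis
  proof (rule that)
    show "degree p = g" "lead_coeff p = 1" using sep_poly_monic[of g] assms by (auto simp: p_def)
    show "inj_on r {..<g}"
    proof (rule inj_onI)
      fix j k assume jk: "j \<in> {..<g}" "k \<in> {..<g}" "r j = r k"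
      then have "4 * real k - 2 < 4 * real j + 2" "4 * real j - 2 < 4 * real k + 2"
        using r by (metis less_trans)+
      then show "j = k" by linarith
    qed
    show "r 1 > 1" using bspec[OF r, of 1] assms by simp
    show "poly (of_int_poly p) (r k) = 0" if "k < g" for k using r that by auto
    show "poly (of_int_poly a) (r k) \<noteq> 0" if "k < g" "a \<noteq> 0" "degree a < g" for k a
      using sep_poly_minimal[of g "r k" a] r that assms by (auto simp: p_def)
    show "r k * poly (of_int_poly h) (r k) = 1" if "k < g" for k
    proof -
      have "poly (of_int_poly (p + 1)) (r k) = poly (of_int_poly ([:0, 1:] * h)) (r k)"
        using ph by simp
      then show ?thesis using r that
        by (simp add: of_int_poly_hom.hom_add of_int_poly_hom.hom_mult of_int_hom.map_poly_pCons_hom)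
    qed
  qed
qed

section \<open>Dynamical degrees and characteristic polynomials\<close>

definition lin_poly :: "(complex \<Rightarrow> 'v \<Rightarrow> 'v) \<Rightarrow> ('v \<Rightarrow> 'v) \<Rightarrow> complex poly \<Rightarrow> 'v::ab_group_add \<Rightarrow> 'v" where
  "lin_poly sc F q x = (\<Sum>k\<le>degree q. sc (coeff q k) ((F ^^ k) x))"

text \<open>The type supplies a finite real dimension, while the complex scalar action is passed as
  \<open>sc\<close>, so that matrices can be treated as vectors. \<open>S\<close> is an invariant
  complex subspace; it will be an eigenspace of the pull-back.\<close>

locale complex_operator =
  fixes sc :: "complex \<Rightarrow> 'v \<Rightarrow> 'v::euclidean_space" and F :: "'v \<Rightarrow> 'v" and S :: "'v set"
  assumes vs: "vector_space sc"
    and sc_real: "sc (complex_of_real r) x = r *\<^sub>R x"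
    and F_add: "F (x + y) = F x + F y" and F_sc: "F (sc c x) = sc c (F x)"
    and S_0: "0 \<in> S" and S_add: "x \<in> S \<Longrightarrow> y \<in> S \<Longrightarrow> x + y \<in> S"
    and S_sc: "x \<in> S \<Longrightarrow> sc c x \<in> S" and S_F: "x \<in> S \<Longrightarrow> F x \<in> S"
begin

interpretation vector_space sc by (rule vs)

abbreviation "ap \<equiv> lin_poly sc F"

lemma F_0: "F 0 = 0"
  using F_add[of 0 0] by simp

lemma F_sum: "F (sum f A) = (\<Sum>a\<in>A. F (f a))"
  by (induction A rule: infinite_finite_induct) (auto simp: F_0 F_add)

lemma S_sum: "(\<And>a. a \<in> A \<Longrightarrow> f a \<in> S) \<Longrightarrow> sum f A \<in> S"
  by (induction A rule: infinite_finite_induct) (auto simp: S_0 S_add)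

lemma ap_ge: "degree q \<le> n \<Longrightarrow> ap q x = (\<Sum>k\<le>n. sc (coeff q k) ((F ^^ k) x))"
  unfolding lin_poly_def by (rule sum.mono_neutral_left) (auto simp: coeff_eq_0)

lemma ap_S: "x \<in> S \<Longrightarrow> ap q x \<in> S"
proof -
  assume "x \<in> S"
  then have "(F ^^ k) x \<in> S" for k by (induction k) (auto simp: S_F)
  then show ?thesis unfolding lin_poly_def by (intro S_sum S_sc) auto
qed

lemma ap_linear_factor: "ap ([:- a, 1:] * q) x = F (ap q x) - sc a (ap q x)"
proof -
  let ?n = "degree q"
  have deg: "degree ([:- a, 1:] * q) \<le> Suc ?n"
    using degree_mult_le[of "[:- a, 1:]" q] by simp
  have c: "coeff ([:- a, 1:] * q) k = (if k = 0 then 0 else coeff q (k - 1)) - a * coeff q k" for k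
    by (cases k) (auto simp: coeff_pCons)
  have "ap ([:- a, 1:] * q) x = (\<Sum>k\<le>Suc ?n. sc (if k = 0 then 0 else coeff q (k - 1)) ((F ^^ k) x))
          - (\<Sum>k\<le>Suc ?n. sc a (sc (coeff q k) ((F ^^ k) x)))"
    unfolding ap_ge[OF deg] c scale_left_diff_distrib sum_subtractf by simp
  also have "(\<Sum>k\<le>Suc ?n. sc (if k = 0 then 0 else coeff q (k - 1)) ((F ^^ k) x)) = F (ap q x)"
    unfolding lin_poly_def F_sum by (subst sum.atMost_Suc_shift) (simp add: F_sc)
  also have "(\<Sum>k\<le>Suc ?n. sc a (sc (coeff q k) ((F ^^ k) x))) = sc a (ap q x)"
    unfolding ap_ge[of q "Suc ?n" x, OF le_SucI[OF le_refl]] scale_sum_right ..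
  finally show ?thesis .
qed

text \<open>Split off a linear factor X - a with cofactor q'. Either q'(F) already kills x, and the
  induction continues, or q'(F) x is an eigenvector for a.\<close>

lemma eigenvector_if_ap_eq_0:
  "q \<noteq> 0 \<Longrightarrow> x \<in> S \<Longrightarrow> x \<noteq> 0 \<Longrightarrow> ap q x = 0 \<Longrightarrow> \<exists>y\<in>S. y \<noteq> 0 \<and> (\<exists>a. F y = sc a y)"
proof (induction "degree q" arbitrary: q)
  case 0
  then obtain c where "q = [:c:]" by (metis degree_eq_zeroE)
  then have "sc c x = 0" "c \<noteq> 0" using 0 by (auto simp: lin_poly_def)
  then show ?case using \<open>x \<noteq> 0\<close> by simp
next
  case (Suc n)
  then have "\<not> constant (poly q)" by (simp add: constant_degree)
  then obtain a where "poly q a = 0" using fundamental_theorem_of_algebra by blast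
  then obtain q' where q': "q = [:- a, 1:] * q'" by (metis poly_eq_0_iff_dvd dvdE)
  then have "q' \<noteq> 0" using Suc by auto
  then have "n = degree q'" using Suc(2) unfolding q' by (subst (asm) degree_mult_eq) auto
  show ?case
  proof (cases "ap q' x = 0")
    case True
    then show ?thesis using Suc.hyps(1)[OF \<open>n = degree q'\<close> \<open>q' \<noteq> 0\<close>] Suc.prems by blast
  next
    case False
    moreover have "F (ap q' x) = sc a (ap q' x)"
      using Suc.prems(4) unfolding q' ap_linear_factor by simp
    ultimately show ?thesis using ap_S[OF \<open>x \<in> S\<close>] by blast
  qed
qed

text \<open>In real dimension N the N + 1 vectors x, F x, ..., F^N x satisfy a linear relation,
  whose coefficients form an annihilating polynomial.\<close>

lemma eigenvector_exists:
  assumes "x \<in> S" "x \<noteq> 0"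
  shows "\<exists>y\<in>S. y \<noteq> 0 \<and> (\<exists>a. F y = sc a y)"
proof -
  let ?f = "\<lambda>k. (F ^^ k) x" and ?N = "DIM('v)"
  have "\<exists>c :: nat \<Rightarrow> real. (\<exists>k\<le>?N. c k \<noteq> 0) \<and> (\<Sum>k\<le>?N. c k *\<^sub>R ?f k) = 0"
  proof (cases "inj_on ?f {..?N}")
    case True
    then have "card (?f ` {..?N}) = Suc ?N" by (simp add: card_image)
    then have "real_vector.dependent (?f ` {..?N})"
      using independent_bound[of "?f ` {..?N}"] by fastforce
    then obtain u where u: "\<exists>v\<in>?f ` {..?N}. u v \<noteq> (0::real)" "(\<Sum>v\<in>?f ` {..?N}. u v *\<^sub>R v) = 0"
      by (auto simp: real_vector.dependent_finite)
    show ?thesis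
      by (rule exI[of _ "\<lambda>k. u (?f k)"]) (use u True in \<open>auto simp: sum.reindex\<close>)
  next
    \<comment> \<open>Two equal iterates already give a relation, one that dependence of the image
      set would not detect.\<close>
    case False
    then obtain i j where ij: "i \<le> ?N" "j \<le> ?N" "i \<noteq> j" "?f i = ?f j" by (auto simp: inj_on_def)
    have "(\<Sum>k\<le>?N. ((if k = i then 1 else 0) - (if k = j then 1 else (0::real))) *\<^sub>R ?f k)
        = (\<Sum>k\<le>?N. if k = i then ?f i else 0) - (\<Sum>k\<le>?N. if k = j then ?f j else 0)"
      by (subst sum_subtractf[symmetric]) (auto intro!: sum.cong)
    also have "\<dots> = 0" using ij by simp
    finally show ?thesis using ij
      by (intro exI[of _ "\<lambda>k. (if k = i then 1 else 0) - (if k = j then 1 else (0::real))"]) auto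
  qed
  then obtain c :: "nat \<Rightarrow> real" and k where c: "k \<le> ?N" "c k \<noteq> 0" "(\<Sum>k\<le>?N. c k *\<^sub>R ?f k) = 0" by blast
  define q where "q = (\<Sum>k\<le>?N. monom (complex_of_real (c k)) k)"
  have coeff: "coeff q k = (if k \<le> ?N then complex_of_real (c k) else 0)" for k
    by (simp add: q_def coeff_sum)
  have "q \<noteq> 0" using coeff[of k] c by auto
  have "degree q \<le> ?N" by (rule degree_le) (simp add: coeff)
  then have "ap q x = 0" using c(3) by (simp add: ap_ge coeff sc_real)
  then show ?thesis using eigenvector_if_ap_eq_0[OF \<open>q \<noteq> 0\<close> assms] by blast
qed

end

section \<open>Eigenvalues of the pull-back on H^{1,1}\<close>

definition left_eigenvalues :: "complex^'n^'n \<Rightarrow> complex set" where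
  "left_eigenvalues M = {\<alpha>. \<exists>h. h \<noteq> 0 \<and> transpose M *v h = \<alpha> *s h}"

lemma right_eigenvalue_imp_left:
  fixes M :: "complex^'n^'n"
  assumes "z \<noteq> 0" "M *v z = \<alpha> *s z"
  shows "\<alpha> \<in> left_eigenvalues M"
proof -
  let ?N = "M - mat \<alpha>"
  have sc: "mat \<alpha> *v x = \<alpha> *s x" for x :: "complex^'n"
    by (simp add: vec_eq_iff matrix_vector_mult_def mat_def if_distrib[of "\<lambda>u. u * _"] cong: if_cong)
  have "?N *v z = 0" using assms by (simp add: matrix_vector_mult_diff_rdistrib sc)
  then have "\<not> invertible ?N"
    using assms(1) matrix_left_invertible_ker[of ?N] invertible_left_inverse by blast
  then have "\<not> invertible (transpose ?N)" by (simp add: invertible_det_nz)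
  then obtain h where "h \<noteq> 0" "transpose ?N *v h = 0"
    using matrix_left_invertible_ker[of "transpose ?N"] invertible_left_inverse by blast
  moreover have "transpose ?N = transpose M - mat \<alpha>"
    by (simp add: vec_eq_iff transpose_def mat_def)
  ultimately show ?thesis
    by (auto simp: left_eigenvalues_def matrix_vector_mult_diff_rdistrib sc)
qed

lemma pullback11_entry:
  "pullback11 M H $ i $ j = (\<Sum>l\<in>UNIV. (\<Sum>k\<in>UNIV. M $ k $ i * H $ k $ l) * cnj (M $ l $ j))"
  by (simp add: pullback11_def matrix_matrix_mult_def transpose_def mconj_def)

text \<open>The factors $H \mapsto M^T H$ and $H \mapsto H \overline M$ of the pull-back commute, so
  every eigenspace of the pull-back contains an eigenvector of the first one.\<close>

lemma pullback11_eigenvalue_product: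
  fixes M H :: "complex^'n^'n"
  assumes "H \<noteq> 0" and H: "pullback11 M H = (\<chi> i j. \<mu> * H $ i $ j)"
  shows "\<exists>\<alpha>\<in>left_eigenvalues M. \<mu> = 0 \<or> (\<exists>\<beta>\<in>left_eigenvalues M. \<mu> = \<alpha> * cnj \<beta>)"
proof -
  define sc :: "complex \<Rightarrow> complex^'n^'n \<Rightarrow> complex^'n^'n" where "sc = (\<lambda>c X. \<chi> i j. c * X $ i $ j)"
  define S where "S = {X. pullback11 M X = sc \<mu> X}"
  have mul_sc: "A ** sc c X = sc c (A ** X)" "sc c X ** A = sc c (X ** A)" for A X c
    by (simp_all add: vec_eq_iff matrix_matrix_mult_def sc_def sum_distrib_left algebra_simps)
  have mul_add: "(X + Y) ** A = X ** A + Y ** A" for X Y A :: "complex^'n^'n"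
    by (simp add: vec_eq_iff matrix_matrix_mult_def sum.distrib algebra_simps)
  interpret complex_operator sc "\<lambda>X. transpose M ** X" S
  proof
    show "0 \<in> S"
      by (simp add: S_def sc_def vec_eq_iff pullback11_entry)
    show "x + y \<in> S" if "x \<in> S" "y \<in> S" for x y
      using that by (simp add: S_def pullback11_def matrix_add_ldistrib mul_add)
        (simp add: sc_def vec_eq_iff algebra_simps)
    show "sc c x \<in> S" if "x \<in> S" for x c
      using that by (simp add: S_def pullback11_def mul_sc) (simp add: sc_def vec_eq_iff algebra_simps)
    show "transpose M ** x \<in> S" if "x \<in> S" for x
      using that by (simp add: S_def pullback11_def matrix_mul_assoc[symmetric])
        (simp add: mul_sc)
  qed (simp_all add: sc_def vec_eq_iff algebra_simps scaleR_conv_of_real[where 'a = complex] matrix_matrix_mult_def sum.distrib sum_distrib_left)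
  have "H \<in> S" using H by (simp add: S_def sc_def)
  then obtain X \<alpha> where X: "X \<in> S" "X \<noteq> 0" and \<alpha>: "transpose M ** X = sc \<alpha> X"
    using eigenvector_exists \<open>H \<noteq> 0\<close> by blast
  obtain i j where ij: "X $ i $ j \<noteq> 0" using X(2) by (auto simp: vec_eq_iff)
  \<comment> \<open>A column of the common eigenvector \<open>X\<close> yields \<alpha>; a
    conjugated row will yield \<beta>.\<close>
  have "transpose M *v (\<chi> k. X $ k $ j) = \<alpha> *s (\<chi> k. X $ k $ j)"
    using \<alpha> by (simp add: vec_eq_iff matrix_vector_mult_def matrix_matrix_mult_def sc_def)
  moreover have "(\<chi> k. X $ k $ j) \<noteq> 0" using ij by (auto simp: vec_eq_iff)
  ultimately have mem: "\<alpha> \<in> left_eigenvalues M" by (auto simp: left_eigenvalues_def)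
  have "sc \<alpha> (X ** mconj M) = sc \<mu> X"
    using X(1) \<alpha> by (simp add: S_def pullback11_def mul_sc)
  then have e: "\<alpha> * (X ** mconj M) $ k $ l = \<mu> * X $ k $ l" for k l
    by (simp add: sc_def vec_eq_iff)
  show ?thesis
  proof (cases "\<alpha> = 0")
    case True
    then have "\<mu> = 0" using e[of i j] ij by simp
    then show ?thesis using mem by blast
  next
    case False
    let ?h = "\<chi> l. cnj (X $ i $ l)" and ?\<beta> = "cnj (\<mu> / \<alpha>)"
    have "(X ** mconj M) $ i $ l = \<mu> / \<alpha> * X $ i $ l" for l
      using e[of i l] False by (simp add: field_simps)
    from arg_cong[OF this, of cnj] have "transpose M *v ?h = ?\<beta> *s ?h"
      by (simp add: vec_eq_iff matrix_vector_mult_def matrix_matrix_mult_def mconj_def transpose_def mult.commute)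
    moreover have "?h \<noteq> 0" using ij by (auto simp: vec_eq_iff)
    ultimately have "?\<beta> \<in> left_eigenvalues M" unfolding left_eigenvalues_def by blast
    moreover have "\<mu> = \<alpha> * cnj ?\<beta>" using False by simp
    ultimately show ?thesis using mem by blast
  qed
qed

text \<open>A left eigenvector h is an invariant 1-form scaled by \<alpha>, and the rank one matrix
  h h^* is its product with the conjugate form. So the supremum defining the dynamical degree is
  attained.\<close>

lemma pullback11_eigenvalue_square:
  assumes "\<alpha> \<in> left_eigenvalues M"
  shows "\<exists>H. H \<noteq> 0 \<and> pullback11 M H = (\<chi> i j. (\<alpha> * cnj \<alpha>) * H $ i $ j)"
proof -
  obtain h where h: "h \<noteq> 0" "transpose M *v h = \<alpha> *s h"
    using assms by (auto simp: left_eigenvalues_def)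
  then have e: "(\<Sum>k\<in>UNIV. M $ k $ i * h $ k) = \<alpha> * h $ i" for i
    by (simp add: vec_eq_iff matrix_vector_mult_def transpose_def)
  let ?H = "\<chi> i j. h $ i * cnj (h $ j)"
  obtain i where "h $ i \<noteq> 0" using h(1) by (auto simp: vec_eq_iff)
  then have "?H \<noteq> 0" by (auto simp: vec_eq_iff)
  moreover have "pullback11 M ?H $ i $ j = (\<alpha> * cnj \<alpha>) * ?H $ i $ j" for i j
  proof -
    have "pullback11 M ?H $ i $ j = (\<Sum>l\<in>UNIV. (\<Sum>k\<in>UNIV. M $ k $ i * h $ k) * cnj (M $ l $ j * h $ l))"
      unfolding pullback11_entry sum_distrib_left sum_distrib_right
      by (intro sum.cong) (simp_all add: algebra_simps)
    also have "\<dots> = \<alpha> * h $ i * cnj (\<Sum>l\<in>UNIV. M $ l $ j * h $ l)"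
      unfolding e[of i] cnj_sum sum_distrib_left by simp
    also have "\<dots> = (\<alpha> * cnj \<alpha>) * ?H $ i $ j" unfolding e by simp
    finally show ?thesis .
  qed
  ultimately show ?thesis by (intro exI[of _ ?H]) (simp add: vec_eq_iff)
qed

section \<open>The integral characteristic polynomial of an endomorphism\<close>

lemma full_lattice_basis:
  fixes L :: "(complex^'n::finite) set"
  assumes "full_lattice L"
  obtains b :: "nat \<Rightarrow> complex^'n" where
    "L = {\<Sum>j<DIM(complex^'n). of_int (k j) *\<^sub>R b j | k. True}"
    "\<And>c. (\<Sum>j<DIM(complex^'n). c j *\<^sub>R b j) = 0 \<Longrightarrow> \<forall>j<DIM(complex^'n). c j = 0"
    "\<And>z. \<exists>c. z = (\<Sum>j<DIM(complex^'n). c j *\<^sub>R b j)"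
proof -
  let ?d = "DIM(complex^'n)"
  obtain B where B: "independent B" "card B = ?d"
      "L = {\<Sum>b\<in>B. of_int (k b) *\<^sub>R b | k. True}"
    using assms unfolding full_lattice_def by blast
  have "finite B" using B(1) independent_bound by blast
  then obtain b where b: "bij_betw b {..<?d} B"
    using ex_bij_betw_nat_finite[of B] B(2) by (auto simp: atLeast0LessThan)
  then have inj: "inj_on b {..<?d}" and im: "B = b ` {..<?d}" by (auto simp: bij_betw_def)
  have sumB: "(\<Sum>v\<in>B. f v) = (\<Sum>j<?d. f (b j))" for f :: "_ \<Rightarrow> complex^'n"
    unfolding im by (subst sum.reindex[OF inj]) (simp add: o_def)
  define b' where "b' = the_inv_into {..<?d} b"
  have b': "b' (b j) = j" if "j < ?d" for j
    unfolding b'_def using the_inv_into_f_f[OF inj] that by simp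
  show ?thesis
  proof (rule that[of b])
    show "L = {\<Sum>j<?d. of_int (k j) *\<^sub>R b j | k. True}"
    proof (intro equalityI subsetI)
      fix x assume "x \<in> L"
      then obtain k where "x = (\<Sum>v\<in>B. of_int (k v) *\<^sub>R v)" using B(3) by auto
      then have "x = (\<Sum>j<?d. of_int (k (b j)) *\<^sub>R b j)" unfolding sumB .
      then show "x \<in> {\<Sum>j<?d. of_int (k j) *\<^sub>R b j | k. True}" by (intro CollectI exI[of _ "\<lambda>j. k (b j)"]) simp
    next
      fix x assume "x \<in> {\<Sum>j<?d. of_int (k j) *\<^sub>R b j | k. True}"
      then obtain k where "x = (\<Sum>j<?d. of_int (k j) *\<^sub>R b j)" by auto
      then have "x = (\<Sum>v\<in>B. of_int (k (b' v)) *\<^sub>R v)" unfolding sumB by (simp add: b')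
      then show "x \<in> L" using B(3) by (auto intro: exI[of _ "\<lambda>v. k (b' v)"])
    qed
    show "\<forall>j<?d. c j = 0" if "(\<Sum>j<?d. c j *\<^sub>R b j) = 0" for c
    proof -
      have "(\<Sum>v\<in>B. c (b' v) *\<^sub>R v) = 0" unfolding sumB using that by (simp add: b')
      then have "\<forall>v\<in>B. c (b' v) = 0" 
        using independentD[OF B(1) \<open>finite B\<close> subset_refl, of "\<lambda>v. c (b' v)"] by blast
      then show ?thesis using b' im by auto
    qed
    show "\<exists>c. z = (\<Sum>j<?d. c j *\<^sub>R b j)" for z
    proof -
      have "span B = UNIV"
        using card_eq_dim[of B UNIV] B(1,2) \<open>finite B\<close> unfolding dim_UNIV by blast
      then have "z \<in> span B" by simp
      then obtain u where "z = (\<Sum>v\<in>B. u v *\<^sub>R v)"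
        using \<open>finite B\<close> by (auto simp: span_finite)
      then show ?thesis unfolding sumB by (intro exI[of _ "\<lambda>j. u (b j)"])
    qed
  qed
qed

text \<open>The polynomial is the characteristic polynomial of M in a lattice basis. Over C the
  lattice representation is the sum of M and its conjugate, which explains the alternative a or
  \<open>cnj a\<close>. Only the two inclusions between eigenvalue sets are proved, since
  multiplicities do not affect the largest modulus.\<close>

lemma endo_integer_polynomial:
  fixes L :: "(complex^'n::finite) set"
  assumes "full_lattice L" "endo L M"
  obtains q :: "int poly" and as where
    "lead_coeff q = 1" "degree q = DIM(complex^'n)"
    "of_int_poly q = (\<Prod>a\<leftarrow>as. [:- a, 1:])" "length as = DIM(complex^'n)"
    "\<And>a. a \<in> set as \<Longrightarrow> a \<in> left_eigenvalues M \<or> cnj a \<in> left_eigenvalues M"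
    "left_eigenvalues M \<subseteq> set as"
proof -
  define d where "d = DIM(complex^'n)"
  obtain b where L: "L = {\<Sum>j<d. of_int (k j) *\<^sub>R b j | k. True}"
    and ind: "\<And>c. (\<Sum>j<d. c j *\<^sub>R b j) = 0 \<Longrightarrow> \<forall>j<d. c j = 0"
    and spn: "\<And>z. \<exists>c. z = (\<Sum>j<d. c j *\<^sub>R b j)"
    using full_lattice_basis[OF assms(1), folded d_def] by blast
  have "b j \<in> L" if "j < d" for j
  proof -
    have "(\<Sum>i<d. of_int (if i = j then 1 else (0::int)) *\<^sub>R b i) = (\<Sum>i<d. if i = j then b i else 0)"
      by (intro sum.cong) auto
    also have "\<dots> = b j" using that by (simp)
    finally show ?thesis unfolding L by (intro CollectI exI[of _ "\<lambda>i. if i = j then 1 else 0"]) simp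
  qed
  then have "\<forall>j\<in>{..<d}. \<exists>k :: nat \<Rightarrow> int. M *v b j = (\<Sum>i<d. of_int (k i) *\<^sub>R b i)"
    using assms(2) unfolding endo_def L by blast
  then obtain k :: "nat \<Rightarrow> nat \<Rightarrow> int" where
    k: "\<And>j. j < d \<Longrightarrow> M *v b j = (\<Sum>i<d. of_int (k j i) *\<^sub>R b i)"
    unfolding bchoice_iff by auto
  define Z :: "int mat" where "Z = Matrix.mat d d (\<lambda>(i, j). k j i)"
  define A :: "complex mat" where "A = Matrix.mat d d (\<lambda>(i, j). of_int (k j i))"
  have ZC: "Z \<in> carrier_mat d d" and AC: "A \<in> carrier_mat d d" by (simp_all add: Z_def A_def)
  have AZ: "A = map_mat of_int Z" by (auto simp: A_def Z_def)
  define q where "q = char_poly Z"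
  have qA: "of_int_poly q = char_poly A"
    unfolding q_def AZ using of_int_hom.char_poly_hom[OF ZC] by metis
  obtain as where as: "char_poly A = (\<Prod>a\<leftarrow>as. [:- a, 1:])" "length as = d"
    using char_poly_factorized[OF AC] by blast
  have root: "a \<in> set as \<longleftrightarrow> eigenvalue A a" for a
    unfolding eigenvalue_root_char_poly[OF AC] as(1)
    by (auto simp: poly_prod_list prod_list_zero_iff)
  have R: "x *\<^sub>R z = complex_of_real x *s z" for x and z :: "complex^'n"
    by (simp add: vec_eq_iff scaleR_conv_of_real[where 'a = complex])
  have MR: "M *v (\<Sum>j<d. u j *s b j) = (\<Sum>i<d. (\<Sum>j<d. of_int (k j i) * u j) *s b i)" for u
  proof -
    have "M *v (\<Sum>j<d. u j *s b j) = (\<Sum>j<d. u j *s (M *v b j))"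
      by (simp add: vec.linear_sum[OF matrix_vector_mul_linear_gen] vec.linear_scale[OF matrix_vector_mul_linear_gen])
    also have "\<dots> = (\<Sum>j<d. \<Sum>i<d. (of_int (k j i) * u j) *s b i)"
      by (intro sum.cong) (simp_all add: k R vec.scale_sum_right mult.commute)
    also have "\<dots> = (\<Sum>i<d. (\<Sum>j<d. of_int (k j i) * u j) *s b i)"
      by (subst sum.swap) (simp add: vec.scale_sum_left)
    finally show ?thesis .
  qed
  have right: "a \<in> left_eigenvalues M \<or> cnj a \<in> left_eigenvalues M" if "a \<in> set as" for a
  proof -
    obtain v where v: "v \<in> carrier_vec d" "v \<noteq> 0\<^sub>v d" "A *\<^sub>v v = a \<cdot>\<^sub>v v"
      using \<open>a \<in> set as\<close> AC unfolding root eigenvalue_def eigenvector_def by auto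
    define u where "u = vec_index v"
    have u: "(\<Sum>j<d. of_int (k j i) * u j) = a * u i" if "i < d" for i
      using arg_cong[OF v(3), of "\<lambda>w. vec_index w i"] that v(1) AC
      by (simp add: A_def u_def scalar_prod_def atLeast0LessThan)
    have u': "(\<Sum>j<d. of_int (k j i) * cnj (u j)) = cnj a * cnj (u i)" if "i < d" for i
      using arg_cong[OF u[OF that], of cnj] by simp
    \<comment> \<open>The basis is independent only over R, so the complex combination
      \<open>?z\<close> can vanish although u does not. The conjugate combination then serves
      instead: if both vanished, the real and imaginary parts of u would be real relations.\<close>
    let ?z = "\<Sum>j<d. u j *s b j" and ?z' = "\<Sum>j<d. cnj (u j) *s b j"
    have e: "M *v ?z = a *s ?z" "M *v ?z' = cnj a *s ?z'"
      unfolding MR vec.scale_sum_right by (auto intro!: sum.cong simp: u u')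
    have "?z \<noteq> 0 \<or> ?z' \<noteq> 0"
    proof (rule ccontr)
      assume "\<not> (?z \<noteq> 0 \<or> ?z' \<noteq> 0)"
      then have z: "?z = 0" "?z' = 0" by auto
      have "(\<Sum>j<d. Re (u j) *\<^sub>R b j) = (1/2) *s (?z + ?z')"
        unfolding sum.distrib[symmetric] vec.scale_sum_right
        by (intro sum.cong) (simp_all add: R vec_eq_iff complex_eq_iff field_simps)
      moreover have "(\<Sum>j<d. Im (u j) *\<^sub>R b j) = (- \<i>/2) *s (?z - ?z')"
        unfolding sum_subtractf[symmetric] vec.scale_sum_right
        by (intro sum.cong) (simp_all add: R vec_eq_iff complex_eq_iff field_simps)
      ultimately have "\<forall>j<d. Re (u j) = 0" "\<forall>j<d. Im (u j) = 0"
        using z ind by simp_all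
      then have "v = 0\<^sub>v d" using v(1) by (auto simp: u_def complex_eq_iff)
      then show False using v(2) by simp
    qed
    then show ?thesis using e right_eigenvalue_imp_left by blast
  qed
  have left: "a \<in> set as" if "a \<in> left_eigenvalues M" for a
  proof -
    obtain h where h: "h \<noteq> 0" "transpose M *v h = a *s h"
      using \<open>a \<in> left_eigenvalues M\<close> unfolding left_eigenvalues_def by blast
    define f where "f = (\<lambda>z::complex^'n. \<Sum>i\<in>UNIV. h $ i * z $ i)"
    have fM: "f (M *v z) = a * f z" for z
    proof -
      have "f (M *v z) = (\<Sum>i\<in>UNIV. \<Sum>j\<in>UNIV. h $ i * M $ i $ j * z $ j)"
        by (simp add: f_def matrix_vector_mult_def sum_distrib_left mult.assoc)
      also have "\<dots> = (\<Sum>j\<in>UNIV. (transpose M *v h) $ j * z $ j)"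
        by (subst sum.swap) (simp add: matrix_vector_mult_def transpose_def sum_distrib_left mult_ac)
      finally show ?thesis unfolding h(2) by (simp add: f_def sum_distrib_left mult.assoc)
    qed
    have f_sum: "f (\<Sum>j<d. c j *\<^sub>R b j) = (\<Sum>j<d. of_real (c j) * f (b j))" for c
      unfolding f_def by (simp add: sum_distrib_left, subst sum.swap)
        (simp add: scaleR_conv_of_real[where 'a = complex] algebra_simps)
    \<comment> \<open>The values of the linear form on the lattice basis: evaluating f(M b_j) = a
      f(b_j) in this basis is the eigenvector equation for the transposed integer matrix.\<close>
    define v where "v = Matrix.vec d (\<lambda>j. f (b j))"
    have "transpose_mat A *\<^sub>v v = a \<cdot>\<^sub>v v"
    proof (rule eq_vecI)
      fix j assume "j < dim_vec (a \<cdot>\<^sub>v v)"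
      then have j: "j < d" by (simp add: v_def)
      have "vec_index (transpose_mat A *\<^sub>v v) j = (\<Sum>i<d. of_int (k j i) * f (b i))"
        using j by (simp add: A_def v_def scalar_prod_def atLeast0LessThan)
      also have "\<dots> = f (M *v b j)" unfolding k[OF j] f_sum by simp
      finally show "vec_index (transpose_mat A *\<^sub>v v) j = vec_index (a \<cdot>\<^sub>v v) j"
        using j by (simp add: fM v_def)
    qed (simp add: A_def v_def)
    moreover have "v \<noteq> 0\<^sub>v d"
    proof
      assume "v = 0\<^sub>v d"
      then have fb: "f (b j) = 0" if "j < d" for j
        
      proof -
        have "f (b j) = vec_index v j" using that by (simp add: v_def)
        also have "\<dots> = 0" using \<open>v = 0\<^sub>v d\<close> that by simp
        finally show ?thesis .
      qed
      obtain i where i: "h $ i \<noteq> 0" using h(1) by (auto simp: vec_eq_iff)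
      obtain c where c: "axis i 1 = (\<Sum>j<d. c j *\<^sub>R b j)" using spn by blast
      have "f (axis i 1) = h $ i" by (simp add: f_def axis_def if_distrib cong: if_cong)
      moreover have "f (axis i 1) = 0" unfolding c f_sum using fb by simp
      ultimately show False using i by simp
    qed
    ultimately have "eigenvalue (transpose_mat A) a"
      unfolding eigenvalue_def eigenvector_def by (intro exI[of _ v]) (auto simp: v_def A_def)
    then show ?thesis unfolding root using AC
      by (simp add: eigenvalue_root_char_poly[of _ d])
  qed
  show ?thesis
  proof (rule that[of q as])
    show "lead_coeff q = 1" "degree q = DIM(complex^'n)" "length as = DIM(complex^'n)"
      using degree_monic_char_poly[OF ZC] as(2) unfolding d_def[symmetric] by (simp_all add: q_def)
  qed (use qA as right left in auto)
qed

text \<open>Depends on the integer polynomial alone, so finitely many polynomials leave finitely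
  many dynamical degrees.\<close>

definition root_radius :: "int poly \<Rightarrow> real" where
  "root_radius q = Max (cmod ` {z. poly (of_int_poly q) z = 0})"

text \<open>Every eigenvalue of the pull-back is zero or a product \<alpha> \<open>cnj\<close>
  \<beta>, which gives the upper bound. A root of largest modulus is, up to a conjugation that
  preserves the modulus, an eigenvalue of M, and its rank one form attains the bound.\<close>

lemma dyn_deg1_eq:
  fixes M :: "complex^'n::finite^'n"
  assumes as: "of_int_poly q = (\<Prod>a\<leftarrow>as. [:- a, 1:])" "as \<noteq> []"
    and right: "\<And>a. a \<in> set as \<Longrightarrow> a \<in> left_eigenvalues M \<or> cnj a \<in> left_eigenvalues M"
    and left: "left_eigenvalues M \<subseteq> set as"
  shows "dyn_deg1 M = (root_radius q)\<^sup>2"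
    and "\<forall>a\<in>set as. cmod a \<le> root_radius q" and "0 \<le> root_radius q"
proof -
  have rr: "root_radius q = Max (cmod ` set as)"
    unfolding root_radius_def as(1) by (simp add: poly_prod_list prod_list_zero_iff image_def Bex_def conj_commute)
  have fin: "finite (cmod ` set as)" "cmod ` set as \<noteq> {}" using as(2) by auto
  show le: "\<forall>a\<in>set as. cmod a \<le> root_radius q"
    unfolding rr using fin by auto
  then show pos: "0 \<le> root_radius q"
    using as(2) by (metis last_in_set norm_ge_zero order_trans)
  let ?E = "{cmod \<mu> | \<mu>. \<exists>H::complex^'n^'n. H \<noteq> 0 \<and> pullback11 M H = (\<chi> i j. \<mu> * H$i$j)}"
  obtain a where a: "a \<in> set as" "cmod a = root_radius q"
    using Max_in[OF fin] unfolding rr by auto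
  obtain a' where a': "a' \<in> left_eigenvalues M" "cmod a' = root_radius q"
    using right[OF a(1)] a(2) by force
  have "cmod (a' * cnj a') \<in> ?E" using pullback11_eigenvalue_square[OF a'(1)] by blast
  then have "(root_radius q)\<^sup>2 \<in> ?E" using a'(2) by (simp add: norm_mult power2_eq_square)
  moreover have "x \<le> (root_radius q)\<^sup>2" if "x \<in> ?E" for x
  proof -
    obtain \<mu> and H :: "complex^'n^'n" where x: "x = cmod \<mu>" "H \<noteq> 0" "pullback11 M H = (\<chi> i j. \<mu> * H$i$j)"
      using \<open>x \<in> ?E\<close> by auto
    from pullback11_eigenvalue_product[OF x(2,3)] obtain \<alpha> where
      "\<alpha> \<in> left_eigenvalues M" "\<mu> = 0 \<or> (\<exists>\<beta>\<in>left_eigenvalues M. \<mu> = \<alpha> * cnj \<beta>)" by blast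
    then show ?thesis using le left pos unfolding x(1) power2_eq_square
      by (auto simp: norm_mult subset_iff intro!: mult_mono)
  qed
  ultimately show "dyn_deg1 M = (root_radius q)\<^sup>2"
    unfolding dyn_deg1_def by (intro cSup_eq_maximum)
qed

section \<open>Finiteness below a bound, and minima\<close>

lemma coeff_bound_of_roots:
  fixes as :: "complex list"
  assumes "0 \<le> R" "\<And>a. a \<in> set as \<Longrightarrow> cmod a \<le> R"
  shows "cmod (coeff (\<Prod>a\<leftarrow>as. [:- a, 1:]) k) \<le> (1 + R) ^ length as"
  using assms(2)
proof (induction as arbitrary: k)
  case Nil
  then show ?case by (cases k) auto
next
  case (Cons a as)
  let ?q = "\<Prod>a\<leftarrow>as. [:- a, 1:]"
  have IH: "cmod (coeff ?q k) \<le> (1 + R) ^ length as" for k using Cons by simp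
  have "cmod (coeff ([:- a, 1:] * ?q) k) \<le> R * (1 + R) ^ length as + (1 + R) ^ length as"
  proof -
    \<comment> \<open>Multiplying by X - a subtracts a times the coefficients from their shift, so a
      coefficient bound grows by a factor of at most 1 + R.\<close>
    have "cmod (a * coeff ?q k) \<le> R * (1 + R) ^ length as"
      unfolding norm_mult using IH Cons.prems assms(1) by (intro mult_mono) auto
    moreover have "cmod (coeff (pCons 0 ?q) k) \<le> (1 + R) ^ length as"
      using IH assms(1) by (cases k) auto
    moreover have "coeff ([:- a, 1:] * ?q) k = coeff (pCons 0 ?q) k - a * coeff ?q k" by simp
    ultimately show ?thesis using norm_triangle_ineq4 by (smt (verit))
  qed
  then show ?case by (simp add: algebra_simps)
qed

lemma finite_bounded_int_polys:
  "finite {q :: int poly. degree q = n \<and> (\<forall>k. \<bar>coeff q k\<bar> \<le> N)}"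
proof (rule finite_subset)
  show "finite (Poly ` {xs. set xs \<subseteq> {-N..N} \<and> length xs = Suc n})"
    by (intro finite_imageI finite_lists_length_eq) simp
  show "{q :: int poly. degree q = n \<and> (\<forall>k. \<bar>coeff q k\<bar> \<le> N)} \<subseteq> Poly ` {xs. set xs \<subseteq> {-N..N} \<and> length xs = Suc n}"
  proof
    fix q :: "int poly" assume q: "q \<in> {q. degree q = n \<and> (\<forall>k. \<bar>coeff q k\<bar> \<le> N)}"
    let ?xs = "map (coeff q) [0..<Suc n]"
    have "q = Poly ?xs"
      using q by (intro poly_eqI) (auto simp: coeff_Poly_eq nth_default_def coeff_eq_0 simp del: upt_Suc)
    moreover have "set ?xs \<subseteq> {-N..N}" using q by (auto simp: abs_le_iff) (metis minus_le_iff)+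
    ultimately show "q \<in> Poly ` {xs. set xs \<subseteq> {-N..N} \<and> length xs = Suc n}" by force
  qed
qed

lemma finite_dyn_deg1_le:
  "finite {dyn_deg1 M | (L :: (complex^'n::finite) set) M. full_lattice L \<and> endo L M \<and> dyn_deg1 M \<le> C}"
proof (rule finite_subset)
  let ?d = "DIM(complex^'n)"
  \<comment> \<open>The maximum keeps R nonnegative for negative C, where \<open>sqrt\<close> would
    be negative.\<close>
  define R where "R = sqrt (max C 0)"
  let ?Q = "{q :: int poly. degree q = ?d \<and> (\<forall>k. \<bar>coeff q k\<bar> \<le> \<lfloor>(1 + R) ^ ?d\<rfloor>)}"
  show "finite ((\<lambda>q. (root_radius q)\<^sup>2) ` ?Q)" by (intro finite_imageI finite_bounded_int_polys)
  show "{dyn_deg1 M | (L :: (complex^'n) set) M. full_lattice L \<and> endo L M \<and> dyn_deg1 M \<le> C}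
      \<subseteq> (\<lambda>q. (root_radius q)\<^sup>2) ` ?Q"
  proof
    fix x assume "x \<in> {dyn_deg1 M | (L :: (complex^'n) set) M. full_lattice L \<and> endo L M \<and> dyn_deg1 M \<le> C}"
    then obtain L :: "(complex^'n) set" and M where x: "x = dyn_deg1 M" "full_lattice L" "endo L M" "x \<le> C" by blast
    obtain q as where q: "lead_coeff q = 1" "degree q = ?d" and as: "of_int_poly q = (\<Prod>a\<leftarrow>as. [:- a, 1:])" "length as = ?d"
      and ev: "\<And>a. a \<in> set as \<Longrightarrow> a \<in> left_eigenvalues M \<or> cnj a \<in> left_eigenvalues M"
        "left_eigenvalues M \<subseteq> set as"
      using endo_integer_polynomial[OF x(2,3)] by metis
    have "as \<noteq> []" using as(2) by auto
    note dd = dyn_deg1_eq[OF as(1) this ev]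
    have "(root_radius q)\<^sup>2 \<le> C" using x dd(1) by simp
    then have "root_radius q \<le> R" unfolding R_def by (intro real_le_rsqrt) simp
    then have "cmod a \<le> R" if "a \<in> set as" for a using dd(2) that by fastforce
    then have "cmod (coeff (of_int_poly q) k) \<le> (1 + R) ^ ?d" for k
      unfolding as(1) as(2)[symmetric] by (intro coeff_bound_of_roots) (auto simp: R_def)
    then have "\<bar>of_int (coeff q k)\<bar> \<le> (1 + R) ^ ?d" for k by (simp add: coeff_map_poly)
    then have "\<bar>coeff q k\<bar> \<le> \<lfloor>(1 + R) ^ ?d\<rfloor>" for k by (metis le_floor_iff of_int_abs)
    then show "x \<in> (\<lambda>q. (root_radius q)\<^sup>2) ` ?Q" using q x(1) dd(1) by auto
  qed
qed

lemma dyn_deg1_ge_eigenvalue: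
  fixes L :: "(complex^'n::finite) set"
  assumes "full_lattice L" "endo L M" "\<alpha> \<in> left_eigenvalues M"
  shows "(cmod \<alpha>)\<^sup>2 \<le> dyn_deg1 M"
proof -
  obtain q as where as: "of_int_poly q = (\<Prod>a\<leftarrow>as. [:- a, 1:])" "length as = DIM(complex^'n)"
    and ev: "\<And>a. a \<in> set as \<Longrightarrow> a \<in> left_eigenvalues M \<or> cnj a \<in> left_eigenvalues M"
      "left_eigenvalues M \<subseteq> set as"
    using endo_integer_polynomial[OF assms(1,2)] by metis
  have "as \<noteq> []" using as(2) by auto
  note dd = dyn_deg1_eq[OF as(1) this ev]
  have "cmod \<alpha> \<le> root_radius q" using dd(2) ev(2) assms(3) by blast
  then show ?thesis using dd(1) power_mono[of "cmod \<alpha>" "root_radius q" 2] by simp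
qed

text \<open>Only the elements below some chosen c in X compete for the minimum, and these are
  finitely many.\<close>

lemma dyn_deg1_has_min:
  assumes X: "X \<subseteq> {dyn_deg1 M | (L :: (complex^'n::finite) set) M. full_lattice L \<and> endo L M}" and "X \<noteq> {}"
  shows "\<exists>a\<in>X. \<forall>b\<in>X. a \<le> b"
proof -
  obtain c where "c \<in> X" using assms by blast
  let ?Y = "{x \<in> X. x \<le> c}"
  have "finite ?Y"
    by (rule finite_subset[OF _ finite_dyn_deg1_le[where 'n = 'n and C = c]]) (use X in blast)
  moreover have "?Y \<noteq> {}" using \<open>c \<in> X\<close> by auto
  ultimately have m: "Min ?Y \<in> ?Y" "\<forall>y\<in>?Y. Min ?Y \<le> y" by (auto intro: Min_in simp del: mem_Collect_eq)
  define m where "m = Min ?Y"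
  have "m \<in> X" "m \<le> c" "\<forall>y\<in>X. y \<le> c \<longrightarrow> m \<le> y" using m unfolding m_def by auto
  then show ?thesis by (intro bexI[of _ m] ballI) (meson le_cases order_trans)+
qed

section \<open>Simple abelian varieties with real multiplication\<close>

lemma full_latticeI:
  fixes f :: "'i \<Rightarrow> complex^'n::finite"
  assumes "finite I" "card I = DIM(complex^'n)"
    and ind: "\<And>c i. (\<Sum>j\<in>I. c j *\<^sub>R f j) = 0 \<Longrightarrow> i \<in> I \<Longrightarrow> c i = 0"
    and L: "L = {\<Sum>j\<in>I. of_int (k j) *\<^sub>R f j | k. True}"
  shows "full_lattice L"
proof -
  have inj: "inj_on f I"
  proof (rule inj_onI)
    fix i j assume ij: "i \<in> I" "j \<in> I" "f i = f j"
    show "i = j"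
    proof (rule ccontr)
      assume "i \<noteq> j"
      let ?c = "\<lambda>l. (if l = i then 1 else 0) - (if l = j then 1 else (0::real))"
      have "(\<Sum>l\<in>I. ?c l *\<^sub>R f l) = (\<Sum>l\<in>I. if l = i then f i else 0) - (\<Sum>l\<in>I. if l = j then f j else 0)"
        by (subst sum_subtractf[symmetric]) (auto intro!: sum.cong)
      also have "\<dots> = 0" using ij \<open>finite I\<close> by simp
      finally show False using ind[of ?c i] ij(1) \<open>i \<noteq> j\<close> by simp
    qed
  qed
  have sumB: "(\<Sum>b\<in>f ` I. u b *\<^sub>R b) = (\<Sum>j\<in>I. u (f j) *\<^sub>R f j)" for u
    by (subst sum.reindex[OF inj]) (simp add: o_def)
  have inv: "the_inv_into I f (f j) = j" if "j \<in> I" for j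
    using the_inv_into_f_f[OF inj that] .
  show ?thesis unfolding full_lattice_def
  proof (intro exI[of _ "f ` I"] conjI)
    show "card (f ` I) = DIM(complex^'n)" using card_image[OF inj] assms(2) by simp
    show "independent (f ` I)"
    proof (rule independent_if_scalars_zero)
      fix u b assume u: "(\<Sum>b\<in>f ` I. u b *\<^sub>R b) = 0" "b \<in> f ` I"
      then show "u b = 0" using ind[of "\<lambda>j. u (f j)"] unfolding sumB by blast
    qed (use \<open>finite I\<close> in simp)
    show "L = {\<Sum>b\<in>f ` I. of_int (k b) *\<^sub>R b | k. True}"
    proof (intro equalityI subsetI)
      fix x assume "x \<in> L"
      then obtain k where x: "x = (\<Sum>j\<in>I. of_int (k j) *\<^sub>R f j)" unfolding L by blast
      have "x = (\<Sum>b\<in>f ` I. of_int (k (the_inv_into I f b)) *\<^sub>R b)"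
        unfolding sumB x by (intro sum.cong) (simp_all add: inv)
      then show "x \<in> {\<Sum>b\<in>f ` I. of_int (k b) *\<^sub>R b | k. True}"
        by (intro CollectI exI[of _ "\<lambda>b. k (the_inv_into I f b)"]) simp
    next
      fix x assume "x \<in> {\<Sum>b\<in>f ` I. of_int (k b) *\<^sub>R b | k. True}"
      then obtain k where x: "x = (\<Sum>b\<in>f ` I. of_int (k b) *\<^sub>R b)" by blast
      then have "x = (\<Sum>j\<in>I. of_int (k (f j)) *\<^sub>R f j)" unfolding x by (subst sum.reindex[OF inj]) simp
      then show "x \<in> L" unfolding L by (intro CollectI exI[of _ "\<lambda>j. k (f j)"]) simp
    qed
  qed
qed

text \<open>The pair (x, y) goes to y + i s x, coordinatewise. Changing s moves the complex
  structure while the lattice in R^g x R^g stays put.\<close>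

definition cplx_embed :: "('n \<Rightarrow> real) \<Rightarrow> (real^'n) \<times> (real^'n) \<Rightarrow> complex^'n::finite" where
  "cplx_embed s v = (\<chi> i. Complex (snd v $ i) (s i * fst v $ i))"

lemma linear_embed: "linear (cplx_embed s)"
  by (rule linearI) (simp_all add: cplx_embed_def vec_eq_iff complex_eq_iff algebra_simps)

lemma bij_embed:
  assumes "\<And>i. s i \<noteq> 0"
  shows "bij (cplx_embed s)"
proof (rule bijI)
  show "inj (cplx_embed s)"
    using assms by (intro injI) (auto simp: cplx_embed_def vec_eq_iff prod_eq_iff)
  show "surj (cplx_embed s)"
    by (rule surjI[of _ "\<lambda>z. (\<chi> i. Im (z $ i) / s i, \<chi> i. Re (z $ i))"])
      (simp add: cplx_embed_def vec_eq_iff assms)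
qed

lemma embed_times_i:
  assumes "\<And>i. s i \<noteq> 0"
  shows "\<i> *s cplx_embed s (x, y) = cplx_embed s (\<chi> i. y $ i / s i, \<chi> i. - (s i * x $ i))"
  using assms by (simp add: cplx_embed_def vec_eq_iff complex_eq_iff)

definition diagm :: "('n \<Rightarrow> real) \<Rightarrow> complex^'n^'n::finite" where
  "diagm d = (\<chi> i j. if i = j then of_real (d i) else 0)"

lemma diagm_mult_vec: "diagm d *v z = (\<chi> i. of_real (d i) * z $ i)"
  by (simp add: diagm_def matrix_vector_mult_def vec_eq_iff if_distrib[of "\<lambda>u. u * _"] cong: if_cong)

lemma diagm_embed: "diagm d *v cplx_embed s (x, y) = cplx_embed s (\<chi> i. d i * x $ i, \<chi> i. d i * y $ i)"
  by (simp add: diagm_mult_vec cplx_embed_def vec_eq_iff complex_eq_iff)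

lemma diagm_mult: "(\<And>i. d i * d' i = 1) \<Longrightarrow> diagm d ** diagm d' = mat 1"
proof -
  assume d: "\<And>i. d i * d' i = 1"
  have "complex_of_real (d i) * complex_of_real (d' i) = 1" for i
    using d[of i] by (metis of_real_1 of_real_mult)
  then show ?thesis
    by (simp add: diagm_def mat_def matrix_matrix_mult_def vec_eq_iff if_distrib[of "\<lambda>u. u * _"] cong: if_cong)
qed

text \<open>Multiplication by t^K clears the denominators. The exponents K + e_i and K - e_i are
  pairwise distinct, so no coefficients merge and the resulting polynomial is nonzero.\<close>

lemma finite_laurent_zeros:
  fixes A B :: "'n::finite \<Rightarrow> real" and e :: "'n \<Rightarrow> nat"
  assumes e: "inj e" "\<And>i. e i \<ge> 1" and nz: "A i \<noteq> 0 \<or> B i \<noteq> 0"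
  shows "finite {t. t > 0 \<and> (\<Sum>i\<in>UNIV. A i * t ^ e i - B i / t ^ e i) = 0}"
proof -
  define K where "K = (\<Sum>i\<in>UNIV. e i)"
  have K: "e i \<le> K" for i unfolding K_def by (rule member_le_sum) auto
  define P where "P = (\<Sum>i\<in>UNIV. monom (A i) (K + e i) - monom (B i) (K - e i))"
  have c1: "coeff P (K + e i) = A i" and c2: "coeff P (K - e i) = - B i" for i
  proof -
    have ne: "K - e j \<noteq> K + e i" for i j using K[of j] e(2)[of i] by linarith
    have eq: "K - e j = K - e i \<longleftrightarrow> j = i" for i j using K[of j] K[of i] inj_eq[OF e(1)] by (metis diff_diff_cancel)
    have eq': "e j = e i \<longleftrightarrow> j = i" for i j using e(1) by (auto dest: injD)
    show "coeff P (K + e i) = A i" by (simp add: P_def coeff_sum ne eq')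
    show "coeff P (K - e i) = - B i"
      using ne[THEN not_sym] by (simp add: P_def coeff_sum eq sum_negf)
  qed
  have "P \<noteq> 0" using c1[of i] c2[of i] nz by auto
  have "poly P t = 0" if "t > 0" "(\<Sum>i\<in>UNIV. A i * t ^ e i - B i / t ^ e i) = 0" for t
  proof -
    have "poly P t = t ^ K * (\<Sum>i\<in>UNIV. A i * t ^ e i - B i / t ^ e i)"
      unfolding P_def poly_sum sum_distrib_left
      using that(1) K by (intro sum.cong) (simp_all add: poly_monom power_add power_diff field_simps)
    then show ?thesis using that(2) by simp
  qed
  then show ?thesis
    using poly_roots_finite[OF \<open>P \<noteq> 0\<close>] by (elim rev_finite_subset) auto
qed

section \<open>The order Z[x]/(p) and its polarized lattices\<close>

locale real_unit =
  fixes p h :: "int poly" and r :: "'n::finite \<Rightarrow> real"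
  assumes monic: "lead_coeff p = 1" and deg: "degree p = CARD('n)" and inj_r: "inj r"
    and root: "poly (of_int_poly p) (r i) = 0"
    and unit: "r i * poly (of_int_poly h) (r i) = 1"
    and minimal: "a \<noteq> 0 \<Longrightarrow> degree a < CARD('n) \<Longrightarrow> poly (of_int_poly a) (r i) \<noteq> 0"
begin

text \<open>The real embeddings of Z[x]/(p), collected in one vector.\<close>

definition ev :: "int poly \<Rightarrow> real^'n" where
  "ev a = (\<chi> i. poly (of_int_poly a) (r i))"

lemma ev_mult: "ev (a * b) $ i = ev a $ i * ev b $ i"
  by (simp add: ev_def of_int_poly_hom.hom_mult)

lemma ev_diff: "ev (a - b) = ev a - ev b"
  by (simp add: ev_def of_int_poly_hom.hom_minus vec_eq_iff)

lemma ev_0: "ev 0 = 0"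
  by (simp add: ev_def vec_eq_iff)

lemma ev_reduce: obtains c where "degree c < CARD('n)" "ev c = ev a"
proof -
  obtain q c where qc: "pseudo_divmod a p = (q, c)" by fastforce
  have "p \<noteq> 0" using monic by auto
  have eq: "a = p * q + c" and c: "c = 0 \<or> degree c < degree p"
    using pseudo_divmod[OF \<open>p \<noteq> 0\<close> qc] monic by auto
  have "ev c = ev a"
    unfolding eq by (simp add: ev_def of_int_poly_hom.hom_add of_int_poly_hom.hom_mult root)
  moreover have "degree c < CARD('n)" using c deg by auto
  ultimately show ?thesis using that by blast
qed

text \<open>Each single real embedding is injective on Z[x]/(p). In the simplicity proof this turns
  one vanishing coordinate into a vanishing lattice component.\<close>

lemma ev_eq_0: "ev a $ i = 0 \<Longrightarrow> ev a = 0"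
proof -
  assume "ev a $ i = 0"
  moreover obtain c where c: "degree c < CARD('n)" "ev c = ev a" by (rule ev_reduce)
  ultimately have "poly (of_int_poly c) (r i) = 0" by (simp add: ev_def vec_eq_iff)
  then have "c = 0" using minimal c(1) by blast
  then show ?thesis using c(2) ev_0 by simp
qed

lemma poly_eq_0_if_roots:
  fixes q :: "real poly"
  assumes "degree q < CARD('n)" "\<And>i. poly q (r i) = 0"
  shows "q = 0"
proof (rule ccontr)
  assume "q \<noteq> 0"
  have "CARD('n) = card (range r)" using inj_r by (simp add: card_image)
  also have "\<dots> \<le> card {x. poly q x = 0}"
    using poly_roots_finite[OF \<open>q \<noteq> 0\<close>] assms(2) by (intro card_mono) auto
  also have "\<dots> \<le> degree q" using \<open>q \<noteq> 0\<close> by (rule card_poly_roots_bound)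
  finally show False using assms(1) by simp
qed

text \<open>This is p'(r_i), since p is monic with exactly the roots r_j.\<close>

definition w :: "'n \<Rightarrow> real" where
  "w i = (\<Prod>j\<in>UNIV - {i}. r i - r j)"

lemma w_nonzero: "w i \<noteq> 0"
  using inj_r by (auto simp: w_def dest: injD)

text \<open>Reduce a modulo p to c of degree below g and interpolate c at the roots. The Lagrange
  polynomials \<open>l i\<close> are monic of degree g - 1, so the sum is the integer coefficient of
  x^(g-1) in c.\<close>

lemma Euler_sum_integer: "(\<Sum>i\<in>UNIV. ev a $ i / w i) \<in> \<int>"
proof -
  let ?m = "CARD('n) - 1"
  obtain c where c: "degree c < CARD('n)" "ev c = ev a" by (rule ev_reduce)
  define l where "l = (\<lambda>i. \<Prod>j\<in>UNIV - {i}. [:- r j, 1:])"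
  have l_deg: "degree (l i) = ?m" for i
    unfolding l_def by (subst degree_prod_eq_sum_degree) auto
  have "lead_coeff (l i) = 1" for i unfolding l_def lead_coeff_prod by simp
  then have l_lead: "coeff (l i) ?m = 1" for i unfolding l_deg .
  have l_val: "poly (l i) (r k) = (if i = k then w i else 0)" for i k
    unfolding l_def w_def poly_prod by (auto intro!: prod_zero)
  define q where "q = of_int_poly c - (\<Sum>i\<in>UNIV. Polynomial.smult (ev a $ i / w i) (l i))"
  have "degree (\<Sum>i\<in>UNIV. Polynomial.smult (ev a $ i / w i) (l i)) \<le> ?m"
    by (intro degree_sum_le) (auto intro: order_trans[OF degree_smult_le] simp: l_deg)
  moreover have "degree (of_int_poly c :: real poly) \<le> ?m" using c(1) by simp
  ultimately have "degree q \<le> ?m" unfolding q_def by (rule degree_diff_le[rotated])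
  then have "degree q < CARD('n)" using zero_less_card_finite[where 'a = 'n] by linarith
  moreover have "poly q (r k) = 0" for k
  proof -
    have "(\<Sum>i\<in>UNIV. ev a $ i / w i * poly (l i) (r k)) = (\<Sum>i\<in>UNIV. if i = k then ev a $ k else 0)"
      by (intro sum.cong) (auto simp: l_val w_nonzero)
    also have "\<dots> = poly (of_int_poly c) (r k)" unfolding c(2)[symmetric] by (simp add: ev_def)
    finally show ?thesis by (simp add: q_def poly_sum)
  qed
  ultimately have "q = 0" by (rule poly_eq_0_if_roots)
  then have "coeff q ?m = 0" by simp
  then have "(\<Sum>i\<in>UNIV. ev a $ i / w i) = of_int (coeff c ?m)"
    unfolding q_def coeff_diff coeff_sum coeff_smult l_lead by (simp add: coeff_map_poly)
  then show ?thesis by simp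
qed

definition \<Lambda> :: "((real^'n) \<times> (real^'n)) set" where
  "\<Lambda> = range ev \<times> range ev"

lemma countable_\<Lambda>: "countable \<Lambda>"
proof -
  have "range ev = range (\<lambda>xs. ev (Poly xs))"
    by (metis (no_types, lifting) Poly_coeffs full_SetCompr_eq image_cong rangeE rangeI subsetI subset_antisym)
  then show ?thesis unfolding \<Lambda>_def by simp
qed

lemma full_lattice_embed:
  assumes s: "\<And>i. s i \<noteq> 0"
  shows "full_lattice (cplx_embed s ` \<Lambda>)"
proof -
  let ?N = "CARD('n)"
  define x where "x = (\<lambda>k. ev (monom 1 k))"
  \<comment> \<open>The Boolean selects the factor of R^g x R^g that receives the power x^k.
    Independence over R holds because a real polynomial of degree below g cannot vanish at g
    distinct nodes.\<close>
  define f where "f = (\<lambda>(b::bool, k). cplx_embed s (if b then (x k, 0) else (0, x k)))"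
  interpret E: linear "cplx_embed s" by (rule linear_embed)
  have expand: "(\<Sum>j\<in>UNIV \<times> {..<?N}. c j *\<^sub>R f j)
     = cplx_embed s (\<Sum>k<?N. c (True, k) *\<^sub>R x k, \<Sum>k<?N. c (False, k) *\<^sub>R x k)" for c
  proof -
    have "(\<Sum>j\<in>UNIV \<times> {..<?N}. c j *\<^sub>R f j)
       = (\<Sum>k<?N. c (True, k) *\<^sub>R f (True, k)) + (\<Sum>k<?N. c (False, k) *\<^sub>R f (False, k))"
      by (simp add: sum.cartesian_product' UNIV_bool)
    also have "\<dots> = cplx_embed s (\<Sum>k<?N. (c (True, k) *\<^sub>R x k, 0) + (0, c (False, k) *\<^sub>R x k))"
      unfolding f_def E.sum by (simp add: E.scale[symmetric] E.add[symmetric] sum.distrib[symmetric])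
    also have "(\<Sum>k<?N. (c (True, k) *\<^sub>R x k, 0) + (0, c (False, k) *\<^sub>R x k))
       = (\<Sum>k<?N. c (True, k) *\<^sub>R x k, \<Sum>k<?N. c (False, k) *\<^sub>R x k)"
      by (simp add: prod_eq_iff fst_sum snd_sum)
    finally show ?thesis .
  qed
  have indep: "c k = 0" if "(\<Sum>k<?N. c k *\<^sub>R x k) = 0" "k < ?N" for c :: "nat \<Rightarrow> real" and k
  proof -
    define q where "q = (\<Sum>k<?N. monom (c k) k)"
    have coeff: "coeff q k = (if k < ?N then c k else 0)" for k by (simp add: q_def coeff_sum)
    have "poly q (r i) = (\<Sum>k<?N. c k *\<^sub>R x k) $ i" for i
      by (simp add: q_def poly_sum poly_monom x_def ev_def)
    moreover have "degree q < ?N"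
      using coeff by (intro le_less_trans[OF degree_le[of "?N - 1"]]) auto
    ultimately have "q = 0" using that(1) by (intro poly_eq_0_if_roots) simp_all
    then show ?thesis using coeff[of k] that(2) by simp
  qed
  have int_sum: "(\<Sum>k<?N. of_int (c k) *\<^sub>R x k) = ev (\<Sum>k<?N. monom (c k) k)" for c :: "nat \<Rightarrow> int"
    by (simp add: vec_eq_iff x_def ev_def of_int_poly_hom.hom_sum poly_sum poly_monom)
  show ?thesis
  proof (rule full_latticeI[of "UNIV \<times> {..<?N}" f])
    show "card ((UNIV :: bool set) \<times> {..<?N}) = DIM(complex^'n)" by (simp add: card_cartesian_product)
    fix c :: "bool \<times> nat \<Rightarrow> real" and i :: "bool \<times> nat"
    assume c: "(\<Sum>j\<in>UNIV \<times> {..<?N}. c j *\<^sub>R f j) = 0" and i: "i \<in> UNIV \<times> {..<?N}"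
    have "cplx_embed s (\<Sum>k<?N. c (True, k) *\<^sub>R x k, \<Sum>k<?N. c (False, k) *\<^sub>R x k) = cplx_embed s 0"
      using c unfolding expand E.zero .
    then have "(\<Sum>k<?N. c (True, k) *\<^sub>R x k, \<Sum>k<?N. c (False, k) *\<^sub>R x k) = 0"
      by (rule injD[OF bij_is_inj[OF bij_embed[of s, OF s]]])
    then have "(\<Sum>k<?N. c (b, k) *\<^sub>R x k) = 0" for b by (cases b) (auto simp: zero_prod_def)
    then show "c i = 0" using indep[of "\<lambda>k. c (fst i, k)" "snd i"] i by (cases i) auto
  next
    show "cplx_embed s ` \<Lambda> = {\<Sum>j\<in>UNIV \<times> {..<?N}. of_int (k j) *\<^sub>R f j | k. True}"
    proof (intro equalityI subsetI)
      fix z assume "z \<in> cplx_embed s ` \<Lambda>"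
      then obtain a b where z: "z = cplx_embed s (ev a, ev b)" by (auto simp: \<Lambda>_def)
      obtain a' where a': "degree a' < ?N" "ev a' = ev a" by (rule ev_reduce)
      obtain b' where b': "degree b' < ?N" "ev b' = ev b" by (rule ev_reduce)
      have red: "(\<Sum>k<?N. monom (coeff c k) k) = c" if "degree c < ?N" for c :: "int poly"
        using that by (intro poly_eqI) (simp add: coeff_sum coeff_eq_0)
      have "z = (\<Sum>j\<in>UNIV \<times> {..<?N}. of_int (case j of (b, k) \<Rightarrow> if b then coeff a' k else coeff b' k) *\<^sub>R f j)"
        unfolding expand z by (simp add: int_sum red a' b')
      then show "z \<in> {\<Sum>j\<in>UNIV \<times> {..<?N}. of_int (k j) *\<^sub>R f j | k. True}" by blast
    next
      fix z assume "z \<in> {\<Sum>j\<in>UNIV \<times> {..<?N}. of_int (k j) *\<^sub>R f j | k. True}"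
      then obtain k where "z = (\<Sum>j\<in>UNIV \<times> {..<?N}. of_int (k j) *\<^sub>R f j)" by blast
      then have "z = cplx_embed s (ev (\<Sum>l<?N. monom (k (True, l)) l), ev (\<Sum>l<?N. monom (k (False, l)) l))"
        unfolding expand int_sum .
      then show "z \<in> cplx_embed s ` \<Lambda>" by (auto simp: \<Lambda>_def)
    qed
  qed simp
qed

text \<open>With the form diag(\<eta>), the choice of s gives \<eta>_i s_i = 1/w_i. The imaginary
  part on two lattice vectors becomes the Euler sum of ab' - ba', so every positive \<eta> is
  admissible and remains free for the simplicity argument.\<close>

lemma abelian_embed:
  assumes \<eta>: "\<And>i. \<eta> i > 0"
  shows "abelian (cplx_embed (\<lambda>i. 1 / (w i * \<eta> i)) ` \<Lambda>)"
proof -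
  let ?s = "\<lambda>i. 1 / (w i * \<eta> i)" and ?H = "diagm \<eta>"
  have s: "?s i \<noteq> 0" for i using w_nonzero[of i] \<eta>[of i] by simp
  have herm: "herm ?H x y = (\<Sum>i\<in>UNIV. of_real (\<eta> i) * (x $ i * cnj (y $ i)))" for x y
    unfolding herm_def by (simp add: diagm_def if_distrib[of "\<lambda>u. _ * u * _"] if_distrib[of "\<lambda>u. _ * u"] if_distrib[of "\<lambda>u. u * _"] mult_ac cong: if_cong)
  have "Re (herm ?H x x) > 0" if "x \<noteq> 0" for x
  proof -
    obtain k where k: "x $ k \<noteq> 0" using \<open>x \<noteq> 0\<close> by (auto simp: vec_eq_iff)
    have "Re (herm ?H x x) = (\<Sum>i\<in>UNIV. \<eta> i * (cmod (x $ i))\<^sup>2)"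
      by (simp add: herm complex_mult_cnj cmod_power2)
    also have "\<dots> > 0"
      by (rule sum_pos2[of _ k]) (use k \<eta> in \<open>auto intro!: mult_nonneg_nonneg intro: less_imp_le\<close>)
    finally show ?thesis .
  qed
  moreover have "Im (herm ?H u v) \<in> \<int>" if u: "u \<in> cplx_embed ?s ` \<Lambda>" and v: "v \<in> cplx_embed ?s ` \<Lambda>" for u v
  proof -
    obtain a b a' b' where uv: "u = cplx_embed ?s (ev a, ev b)" "v = cplx_embed ?s (ev a', ev b')"
      using u v by (auto simp: \<Lambda>_def)
    have "Im (herm ?H u v) = (\<Sum>i\<in>UNIV. ev (a * b' - b * a') $ i / w i)"
      unfolding herm Im_sum uv
    proof (intro sum.cong)
      fix i
      have "\<eta> i \<noteq> 0" using \<eta>[of i] by simp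
      then show "Im (of_real (\<eta> i) * (cplx_embed ?s (ev a, ev b) $ i * cnj (cplx_embed ?s (ev a', ev b') $ i)))
          = ev (a * b' - b * a') $ i / w i"
        using w_nonzero[of i] by (simp add: cplx_embed_def ev_diff ev_mult field_simps)
    qed simp
    then show ?thesis using Euler_sum_integer by simp
  qed
  ultimately show ?thesis unfolding abelian_def
    using full_lattice_embed[of ?s, OF s] by (intro conjI exI[of _ ?H]) (auto simp: diagm_def)
qed

lemma endo_diagm_ev: "endo (cplx_embed s ` \<Lambda>) (diagm (\<lambda>i. ev c $ i))"
  unfolding endo_def
proof
  fix z assume "z \<in> cplx_embed s ` \<Lambda>"
  then obtain a b where z: "z = cplx_embed s (ev a, ev b)" by (auto simp: \<Lambda>_def)
  have "(\<chi> i. ev c $ i * ev d $ i) = ev (c * d)" for d by (simp add: vec_eq_iff ev_mult)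
  then have "diagm (\<lambda>i. ev c $ i) *v z = cplx_embed s (ev (c * a), ev (c * b))"
    unfolding z diagm_embed by simp
  then show "diagm (\<lambda>i. ev c $ i) *v z \<in> cplx_embed s ` \<Lambda>" by (auto simp: \<Lambda>_def)
qed

lemma auto_diagm: "auto (cplx_embed s ` \<Lambda>) (diagm r)"
proof -
  have r: "(\<lambda>i. ev [:0, 1:] $ i) = r" by (simp add: ev_def of_int_hom.map_poly_pCons_hom)
  have "r i * ev h $ i = 1" for i using unit by (simp add: ev_def)
  then have "diagm r ** diagm (\<lambda>i. ev h $ i) = mat 1" "diagm (\<lambda>i. ev h $ i) ** diagm r = mat 1"
    by (auto intro!: diagm_mult simp: mult.commute)
  then show ?thesis
    unfolding auto_def using endo_diagm_ev[of s "[:0, 1:]"] endo_diagm_ev[of s h] unfolding r by blast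
qed

text \<open>A subtorus is spanned by some finite $S$, so it has a normal vector $(\gamma, \delta)$
  taken from a countable family independent of $t$. That it is stable under multiplication by
  $\mathrm{i}$ is then a Laurent polynomial equation in $t$ with pairwise distinct exponents, one for
  each lattice vector; the good $t$ are those for which it holds only trivially.\<close>

lemma generic_parameter:
  fixes e :: "'n \<Rightarrow> nat"
  assumes e: "inj e" "\<And>i. e i \<ge> 1"
  obtains t :: real where "t > 0"
    "\<And>S. finite S \<Longrightarrow> S \<subseteq> \<Lambda> \<Longrightarrow> span S \<noteq> UNIV \<Longrightarrow>
      \<exists>\<gamma> \<delta>. (\<gamma>, \<delta>) \<noteq> 0 \<and> (\<forall>v\<in>span S. (\<gamma>, \<delta>) \<bullet> v = 0) \<and>
        (\<forall>a b. (a, b) \<in> \<Lambda> \<longrightarrow>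
           (\<Sum>i\<in>UNIV. (\<gamma> $ i * b $ i * w i) * t ^ e i - (\<delta> $ i * a $ i / w i) / t ^ e i) = 0 \<longrightarrow>
           (\<forall>i. \<gamma> $ i * b $ i = 0 \<and> \<delta> $ i * a $ i = 0))"
proof -
  define \<S> where "\<S> = {S. finite S \<and> S \<subseteq> \<Lambda> \<and> span S \<noteq> UNIV}"
  have normal: "\<exists>n. n \<noteq> 0 \<and> (\<forall>v\<in>span S. n \<bullet> v = 0)" if "S \<in> \<S>" for S
  proof -
    have "dim S < DIM((real^'n) \<times> (real^'n))"
      using that dim_eq_full[of S] dim_subset_UNIV[of S] unfolding \<S>_def by fastforce
    then obtain n where "n \<noteq> 0" "\<And>v. v \<in> span S \<Longrightarrow> real_inner_class.orthogonal n v"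
      using orthogonal_to_subspace_exists by blast
    then show ?thesis by (intro exI[of _ n]) (simp add: real_inner_class.orthogonal_def)
  qed
  define n where "n = (\<lambda>S. SOME n :: (real^'n) \<times> (real^'n). n \<noteq> 0 \<and> (\<forall>v\<in>span S. n \<bullet> v = 0))"
  have n: "n S \<noteq> 0 \<and> (\<forall>v\<in>span S. n S \<bullet> v = 0)" if "S \<in> \<S>" for S
    unfolding n_def by (rule someI_ex[OF normal[OF that]])
  define A where "A = (\<lambda>S (v :: (real^'n) \<times> (real^'n)) i. fst (n S) $ i * snd v $ i * w i)"
  define B where "B = (\<lambda>S (v :: (real^'n) \<times> (real^'n)) i. snd (n S) $ i * fst v $ i / w i)"
  \<comment> \<open>Equations with all coefficients zero hold for every t and must be left out, or
    the set of bad parameters would be everything.\<close>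
  define D where "D = (\<lambda>(S, v). {t::real. t > 0 \<and> (\<exists>i. A S v i \<noteq> 0 \<or> B S v i \<noteq> 0) \<and>
        (\<Sum>i\<in>UNIV. A S v i * t ^ e i - B S v i / t ^ e i) = 0})"
  have "finite (D P)" for P :: "((real^'n) \<times> (real^'n)) set \<times> ((real^'n) \<times> (real^'n))"
  proof -
    obtain S v where Pair: "P = (S, v)" by (rule prod.exhaust)
    show ?thesis
    proof (cases "\<exists>i. A S v i \<noteq> 0 \<or> B S v i \<noteq> 0")
      case True
      then obtain i where "A S v i \<noteq> 0 \<or> B S v i \<noteq> 0" by blast
      from finite_laurent_zeros[of e "A S v" i "B S v", OF e this] show ?thesis
        unfolding Pair D_def by (auto elim: rev_finite_subset)
    next
      case False
      then have "D P = {}" unfolding Pair D_def by simp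
      then show ?thesis by simp
    qed
  qed
  moreover have "countable \<S>" unfolding \<S>_def
    by (rule countable_subset[OF _ countable_Collect_finite_subset[OF countable_\<Lambda>]]) auto
  ultimately have "countable (\<Union>P\<in>\<S> \<times> \<Lambda>. D P)"
    using countable_\<Lambda> by (intro countable_UN countable_SIGMA) (auto intro: countable_finite)
  moreover have "uncountable {0<..<1::real}" by (simp add: uncountable_open_interval)
  ultimately have "\<not> {0<..<1} \<subseteq> (\<Union>P\<in>\<S> \<times> \<Lambda>. D P)"
    using countable_subset by blast
  then obtain t where t: "t > 0" "t \<notin> (\<Union>P\<in>\<S> \<times> \<Lambda>. D P)"
    unfolding subset_iff greaterThanLessThan_iff by blast
  show ?thesis
  proof (rule that[OF \<open>t > 0\<close>])
    fix S :: "((real^'n) \<times> (real^'n)) set" assume "finite S" "S \<subseteq> \<Lambda>" "span S \<noteq> UNIV"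
    then have S: "S \<in> \<S>" by (simp add: \<S>_def)
    obtain \<gamma> \<delta> where nS: "n S = (\<gamma>, \<delta>)" by fastforce
    have "\<gamma> $ i * b $ i = 0 \<and> \<delta> $ i * a $ i = 0"
      if "(a, b) \<in> \<Lambda>" "(\<Sum>i\<in>UNIV. (\<gamma> $ i * b $ i * w i) * t ^ e i - (\<delta> $ i * a $ i / w i) / t ^ e i) = 0" for a b i
    proof -
      have "t \<notin> D (S, (a, b))" using t(2) S that(1) by blast
      then have "A S (a, b) i = 0 \<and> B S (a, b) i = 0"
        using that(2) \<open>t > 0\<close> unfolding D_def by (auto simp: A_def B_def nS)
      then show ?thesis using w_nonzero[of i] by (simp add: A_def B_def nS)
    qed
    then show "\<exists>\<gamma> \<delta>. (\<gamma>, \<delta>) \<noteq> 0 \<and> (\<forall>v\<in>span S. (\<gamma>, \<delta>) \<bullet> v = 0) \<and>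
        (\<forall>a b. (a, b) \<in> \<Lambda> \<longrightarrow>
           (\<Sum>i\<in>UNIV. (\<gamma> $ i * b $ i * w i) * t ^ e i - (\<delta> $ i * a $ i / w i) / t ^ e i) = 0 \<longrightarrow>
           (\<forall>i. \<gamma> $ i * b $ i = 0 \<and> \<delta> $ i * a $ i = 0))"
      using n[OF S] unfolding nS by (intro exI[of _ \<gamma>] exI[of _ \<delta>]) blast
  qed
qed

text \<open>For a proper subtorus the normal vector is also orthogonal to i v for its lattice
  vectors v. Genericity of t makes this hold term by term, so one nonzero entry of the normal vector
  kills a whole component of all these v. The subtorus then lies in one of the two real factors and
  is zero.\<close>

lemma simple_embed_exists:
  obtains s where "simple_av (cplx_embed s ` \<Lambda>)"
proof -
  obtain e0 :: "'n \<Rightarrow> nat" where "inj e0"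
    using finite_imp_inj_to_nat_seg[of "UNIV :: 'n set"] by auto
  \<comment> \<open>The shift makes every exponent positive, which separates the powers of t from
    those of 1/t.\<close>
  define e where "e = (\<lambda>i. Suc (e0 i))"
  have e: "inj e" "\<And>i. e i \<ge> 1" using \<open>inj e0\<close> by (auto simp: e_def inj_def)
  obtain t where "t > 0" and gen:
    "\<And>S. finite S \<Longrightarrow> S \<subseteq> \<Lambda> \<Longrightarrow> span S \<noteq> UNIV \<Longrightarrow>
      \<exists>\<gamma> \<delta>. (\<gamma>, \<delta>) \<noteq> 0 \<and> (\<forall>v\<in>span S. (\<gamma>, \<delta>) \<bullet> v = 0) \<and>
        (\<forall>a b. (a, b) \<in> \<Lambda> \<longrightarrow>
           (\<Sum>i\<in>UNIV. (\<gamma> $ i * b $ i * w i) * t ^ e i - (\<delta> $ i * a $ i / w i) / t ^ e i) = 0 \<longrightarrow>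
           (\<forall>i. \<gamma> $ i * b $ i = 0 \<and> \<delta> $ i * a $ i = 0))"
    using generic_parameter[OF e] by blast
  define s where "s = (\<lambda>i. 1 / (w i * t ^ e i))"
  have s: "s i \<noteq> 0" for i using w_nonzero[of i] \<open>t > 0\<close> by (simp add: s_def)
  interpret E: linear "cplx_embed s" by (rule linear_embed)
  have inj: "inj (cplx_embed s)" and surj: "surj (cplx_embed s)" using bij_embed[of s, OF s] by (auto simp: bij_def)
  have ab: "abelian (cplx_embed s ` \<Lambda>)"
    unfolding s_def using \<open>t > 0\<close> by (intro abelian_embed) simp
  have "W = {0} \<or> W = UNIV"
    if W: "subspace W" "\<forall>x\<in>W. \<i> *s x \<in> W" "span (W \<inter> cplx_embed s ` \<Lambda>) = W" for W
  proof (rule disjCI)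
    assume "W \<noteq> UNIV"
    define V where "V = cplx_embed s -` W"
    have "W = cplx_embed s ` V" unfolding V_def using surj by (simp add: surj_image_vimage_eq)
    have V: "subspace V" unfolding V_def by (rule linear_subspace_vimage[OF linear_embed W(1)])
    have J: "(\<chi> i. b $ i / s i, \<chi> i. - (s i * a $ i)) \<in> V" if "(a, b) \<in> V" for a b
      using W(2) that unfolding V_def vimage_eq by (simp add: embed_times_i[of s, OF s, symmetric])
    have "W \<inter> cplx_embed s ` \<Lambda> = cplx_embed s ` (V \<inter> \<Lambda>)"
      unfolding \<open>W = cplx_embed s ` V\<close> using inj by (simp add: image_Int)
    then have "cplx_embed s ` span (V \<inter> \<Lambda>) = cplx_embed s ` V"
      using W(3) \<open>W = cplx_embed s ` V\<close> linear_span_image[OF linear_embed] by metis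
    then have span_V: "span (V \<inter> \<Lambda>) = V" using inj by (simp add: inj_image_eq_iff)
    \<comment> \<open>A basis taken from the lattice vectors is finite and spans V, which places V
      in the countable family covered by the choice of t.\<close>
    obtain S where S: "S \<subseteq> V \<inter> \<Lambda>" "independent S" "V \<inter> \<Lambda> \<subseteq> span S"
      using basis_exists[of "V \<inter> \<Lambda>"] by metis
    have span_S: "span S = V"
      using span_V S(1,3) by (metis span_mono span_span subset_antisym)
    have "V \<noteq> UNIV" using \<open>W \<noteq> UNIV\<close> \<open>W = cplx_embed s ` V\<close> surj by auto
    then obtain \<gamma> \<delta> where nz: "(\<gamma>, \<delta>) \<noteq> 0" and orth: "\<And>v. v \<in> V \<Longrightarrow> (\<gamma>, \<delta>) \<bullet> v = 0"
      and gd: "\<And>a b. (a, b) \<in> \<Lambda> \<Longrightarrow>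
           (\<Sum>i\<in>UNIV. (\<gamma> $ i * b $ i * w i) * t ^ e i - (\<delta> $ i * a $ i / w i) / t ^ e i) = 0 \<Longrightarrow>
           (\<forall>i. \<gamma> $ i * b $ i = 0 \<and> \<delta> $ i * a $ i = 0)"
      using gen[of S] independent_imp_finite[OF S(2)] S(1) unfolding span_S by blast
    have zero: "\<gamma> $ i * b $ i = 0 \<and> \<delta> $ i * a $ i = 0" if "(a, b) \<in> V \<inter> \<Lambda>" for a b i
    proof -
      have "(\<gamma>, \<delta>) \<bullet> (\<chi> i. b $ i / s i, \<chi> i. - (s i * a $ i)) = 0"
        using orth J that by blast
      then have "(\<Sum>i\<in>UNIV. (\<gamma> $ i * b $ i * w i) * t ^ e i - (\<delta> $ i * a $ i / w i) / t ^ e i) = 0"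
        by (simp add: inner_Pair inner_vec_def s_def sum_subtractf sum_negf mult_ac)
      then show ?thesis using gd that by blast
    qed
    have "V \<subseteq> {0}"
    proof (cases "\<gamma> = 0")
      case False
      then obtain i where i: "\<gamma> $ i \<noteq> 0" by (auto simp: vec_eq_iff)
      have "V \<inter> \<Lambda> \<subseteq> UNIV \<times> {0}"
      proof
        fix v assume v: "v \<in> V \<inter> \<Lambda>"
        then obtain a b where ab: "v = (ev a, ev b)" by (auto simp: \<Lambda>_def)
        then show "v \<in> UNIV \<times> {0}" using zero[of "ev a" "ev b" i] v i ev_eq_0[of b i] by auto
      qed
      then have sub: "V \<subseteq> UNIV \<times> {0}"
        using span_minimal[of "V \<inter> \<Lambda>" "UNIV \<times> {0}"] span_V by (simp add: subspace_Times)
      show ?thesis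
      proof
        fix v assume "v \<in> V"
        then obtain a b where v: "v = (a, b)" "b = 0" "(a, b) \<in> V" using sub by auto
        \<comment> \<open>Multiplication by i exchanges the two factors, so V can stay inside one of
          them only if it is zero.\<close>
        have "(\<chi> i. - (s i * a $ i)) = 0" using J[OF v(3)] sub by auto
        then have "a = 0" using s by (simp add: vec_eq_iff)
        then show "v \<in> {0}" using v by (simp add: zero_prod_def)
      qed
    next
      case True
      then obtain i where i: "\<delta> $ i \<noteq> 0" using nz by (auto simp: vec_eq_iff zero_prod_def)
      have "V \<inter> \<Lambda> \<subseteq> {0} \<times> UNIV"
      proof
        fix v assume v: "v \<in> V \<inter> \<Lambda>"
        then obtain a b where ab: "v = (ev a, ev b)" by (auto simp: \<Lambda>_def)
        then show "v \<in> {0} \<times> UNIV" using zero[of "ev a" "ev b" i] v i ev_eq_0[of a i] by auto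
      qed
      then have sub: "V \<subseteq> {0} \<times> UNIV"
        using span_minimal[of "V \<inter> \<Lambda>" "{0} \<times> UNIV"] span_V by (simp add: subspace_Times)
      show ?thesis
      proof
        fix v assume "v \<in> V"
        then obtain a b where v: "v = (a, b)" "a = 0" "(a, b) \<in> V" using sub by auto
        have "(\<chi> i. b $ i / s i) = 0" using J[OF v(3)] sub by auto
        then have "b = 0" using s by (simp add: vec_eq_iff)
        then show "v \<in> {0}" using v by (simp add: zero_prod_def)
      qed
    qed
    then have "W \<subseteq> {0}" unfolding \<open>W = cplx_embed s ` V\<close> using E.zero by auto
    then show "W = {0}" using subspace_0[OF W(1)] by auto
  qed
  then have "simple_av (cplx_embed s ` \<Lambda>)" using ab unfolding simple_av_def by blast
  then show ?thesis by (rule that)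
qed

end

section \<open>The example and the theorem\<close>

lemma simple_auto_exists:
  assumes "CARD('n::finite) \<ge> 2"
  shows "\<exists>(L :: (complex^'n) set) M. simple_av L \<and> auto L M \<and> dyn_deg1 M \<noteq> 1"
proof -
  let ?g = "CARD('n)"
  obtain p h :: "int poly" and r :: "nat \<Rightarrow> real" where
    p: "degree p = ?g" "lead_coeff p = 1" and r: "inj_on r {..<?g}" "r 1 > 1"
    and root: "\<And>k. k < ?g \<Longrightarrow> poly (of_int_poly p) (r k) = 0"
    and unit: "\<And>k. k < ?g \<Longrightarrow> r k * poly (of_int_poly h) (r k) = 1"
    and minimal: "\<And>k a. k < ?g \<Longrightarrow> a \<noteq> 0 \<Longrightarrow> degree a < ?g \<Longrightarrow> poly (of_int_poly a) (r k) \<noteq> 0"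
    using exists_totally_real_unit[OF assms] by metis
  obtain idx where idx: "bij_betw idx (UNIV :: 'n set) {..<?g}"
    using ex_bij_betw_finite_nat[of "UNIV :: 'n set"] by (auto simp: atLeast0LessThan)
  then have lt: "idx i < ?g" for i by (auto simp: bij_betw_def)
  define \<rho> where "\<rho> = (\<lambda>i. r (idx i))"
  interpret real_unit p h \<rho>
  proof
    show "inj \<rho>"
      unfolding \<rho>_def using idx r(1) comp_inj_on[of idx UNIV r] by (simp add: bij_betw_def comp_def)
  qed (use p root unit minimal lt in \<open>auto simp: \<rho>_def\<close>)
  obtain s where simp: "simple_av (cplx_embed s ` \<Lambda>)" by (rule simple_embed_exists)
  have "1 \<in> {..<?g}" using assms by simp
  \<comment> \<open>The root with index 1 is the one known to exceed 1; it is an eigenvalue, so the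
    dynamical degree is at least its square.\<close>
  then obtain i where "idx i = 1" using idx unfolding bij_betw_def by (metis imageE)
  then have i: "\<rho> i > 1" using r(2) by (simp add: \<rho>_def)
  have "diagm \<rho> *v axis i 1 = of_real (\<rho> i) *s axis i 1"
    by (simp add: diagm_mult_vec vec_eq_iff axis_def)
  then have ev: "of_real (\<rho> i) \<in> left_eigenvalues (diagm \<rho>)"
    by (rule right_eigenvalue_imp_left[rotated]) (simp add: axis_eq_0_iff)
  have au: "auto (cplx_embed s ` \<Lambda>) (diagm \<rho>)" by (rule auto_diagm)
  have "full_lattice (cplx_embed s ` \<Lambda>)" "endo (cplx_embed s ` \<Lambda>) (diagm \<rho>)"
    using simp au by (auto simp: simple_av_def abelian_def auto_def)
  then have "(cmod (of_real (\<rho> i)))\<^sup>2 \<le> dyn_deg1 (diagm \<rho>)"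
    by (rule dyn_deg1_ge_eigenvalue) (rule ev)
  moreover have "1 < (\<rho> i)\<^sup>2" using i by (simp add: one_less_power)
  ultimately have "dyn_deg1 (diagm \<rho>) \<noteq> 1" by simp
  then show ?thesis using simp au by blast
qed

lemma auto_imp_surj_endo:
  fixes L :: "(complex^'n::finite) set"
  assumes "full_lattice L" "auto L M"
  shows "surj_endo L M"
proof -
  have "0 \<in> L" using assms(1) by (auto simp: full_lattice_def intro: exI[of _ "\<lambda>_. 0"])
  obtain N where N: "M ** N = mat 1" using assms(2) by (auto simp: auto_def)
  have "M *v (N *v y) - y = 0" for y by (simp add: matrix_vector_mul_assoc N)
  then show ?thesis
    using assms(2) \<open>0 \<in> L\<close> unfolding surj_endo_def auto_def by metis
qed

text \<open>Both sets consist of dynamical degrees of lattice endomorphisms, so only nonemptiness is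
  at stake. An automorphism is a surjective endomorphism, hence the one simple example settles
  both.\<close>

theorem theoremC:
  assumes "CARD('n::finite) \<ge> 2"
  shows "(\<exists>a\<in>{dyn_deg1 M | (L :: (complex^'n) set) M. abelian L \<and> surj_endo L M} - {1}.
            \<forall>b\<in>{dyn_deg1 M | (L :: (complex^'n) set) M. abelian L \<and> surj_endo L M} - {1}. a \<le> b)
       \<and> (\<exists>a\<in>{dyn_deg1 M | (L :: (complex^'n) set) M. simple_av L \<and> auto L M} - {1}.
            \<forall>b\<in>{dyn_deg1 M | (L :: (complex^'n) set) M. simple_av L \<and> auto L M} - {1}. a \<le> b)"
proof -
  obtain L :: "(complex^'n) set" and M where
    LM: "simple_av L" "auto L M" "dyn_deg1 M \<noteq> 1"
    using simple_auto_exists[OF assms] by blast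
  then have LM': "abelian L" "surj_endo L M"
    using auto_imp_surj_endo by (auto simp: simple_av_def abelian_def)
  show ?thesis
  proof
    show "\<exists>a\<in>{dyn_deg1 M | (L :: (complex^'n) set) M. abelian L \<and> surj_endo L M} - {1}.
            \<forall>b\<in>{dyn_deg1 M | (L :: (complex^'n) set) M. abelian L \<and> surj_endo L M} - {1}. a \<le> b"
    proof (rule dyn_deg1_has_min[where 'n = 'n])
      show "{dyn_deg1 M | (L :: (complex^'n) set) M. abelian L \<and> surj_endo L M} - {1}
          \<subseteq> {dyn_deg1 M | (L :: (complex^'n) set) M. full_lattice L \<and> endo L M}"
        unfolding abelian_def surj_endo_def by blast
    qed (use LM' LM(3) in blast)
    show "\<exists>a\<in>{dyn_deg1 M | (L :: (complex^'n) set) M. simple_av L \<and> auto L M} - {1}.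
            \<forall>b\<in>{dyn_deg1 M | (L :: (complex^'n) set) M. simple_av L \<and> auto L M} - {1}. a \<le> b"
    proof (rule dyn_deg1_has_min[where 'n = 'n])
      show "{dyn_deg1 M | (L :: (complex^'n) set) M. simple_av L \<and> auto L M} - {1}
          \<subseteq> {dyn_deg1 M | (L :: (complex^'n) set) M. full_lattice L \<and> endo L M}"
        unfolding simple_av_def abelian_def auto_def by blast
    qed (use LM in blast)
  qed
qed

end
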